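(* Let $\nu\in\mathcal{V}$ be a valuation on $\mathbb{K}[x]$ extending $\nu_0$, let $n\in\mathbb{N}$, and let $\Psi_n$ be the set of all key polynomials for $\nu$ of degree $n$. Assume that $\Psi_n\neq\emptyset$ and that $\{\nu(Q)\mid Q\in\Psi_n\}$ does not have a maximum, and let $Q_n$ be a limit key polynomial for $\Psi_n$. Let $R_{Q_n}$ be the additive subgroup of $\mathcal{G}_{Q_n}$ generated by $\{\mathrm{in}_{Q_n}(f)\mid f\in\mathbb{K}[x],\ \deg(f)<\deg(Q_n)\}$ (it is a subring of $\mathcal{G}_{Q_n}$), and consider the direct system $\{(\mathcal{G}_Q,\phi_{QQ'})\}_{Q\preceq Q'}^{Q,Q'\in\Psi_n}$. Then $$\varinjlim\mathcal{G}_Q\cong R_{Q_n}$$ as commutative rings with unity, and $$\mathcal{G}_{Q_n}\cong\bigl(\varinjlim\mathcal{G}_Q\bigr)[Y],$$ where $Y$ is an indeterminate over $\varinjlim\mathcal{G}_Q$.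
   Context: A valuation on a commutative ring $A$ with unity is a map $\nu:A\to\Gamma_\infty=\Gamma\cup\{\infty\}$, with $\Gamma$ a totally ordered abelian group, such that $\nu(ab)=\nu(a)+\nu(b)$, $\nu(a+b)\ge\min\{\nu(a),\nu(b)\}$, $\nu(1)=0$, $\nu(0)=\infty$. Its support is $\mathrm{supp}(\nu)=\{a\mid\nu(a)=\infty\}$, which may be non-zero. Let $\mathbb{K}$ be a field, $\nu_0$ a valuation on $\mathbb{K}$ with support $\{0\}$ and value group $\Gamma_0$, and fix a totally ordered divisible abelian group $\Gamma\supseteq\Gamma_0$. Put $\mathcal{V}=\{\nu_0\}\cup\{\nu:\mathbb{K}[x]\to\Gamma_\infty\mid \nu\text{ is a valuation extending }\nu_0\}$. For valuations $\nu,\mu$ on $\mathbb{K}[x]$, $\nu\le\mu$ means $\nu(f)\le\mu(f)$ for all $f\in\mathbb{K}[x]$. Key polynomials: let $\overline{\mathbb{K}}$ be an algebraic closure of $\mathbb{K}$ and $\overline{\nu}$ a valuation on $\overline{\mathbb{K}}[x]$ extending $\nu$. For non-zero $f$ put $\delta(f)=\max\{\overline{\nu}(x-a)\mid a\in\overline{\mathbb{K}},\ f(a)=0\}$ if $\deg(f)>0$ and $\delta(f)=-\infty$ if $\deg(f)=0$; this is independent of the choices. A monic $Q\in\mathbb{K}[x]$ is a key polynomial for $\nu$ if for every non-zero $f\in\mathbb{K}[x]$, $\delta(f)\ge\delta(Q)$ implies $\deg(f)\ge\deg(Q)$. For a non-constant $q\in\mathbb{K}[x]$, the $q$-expansion of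 $f$ is the unique expression $f=f_0+f_1q+\cdots+f_sq^s$ with $\deg(f_i)<\deg(q)$ for all $i$. The truncation of $\nu$ at $q$ is $\nu_q(f)=\min_{0\le i\le s}\{\nu(f_iq^i)\}$; it is a valuation when $q$ is a key polynomial for $\nu$. Let $\mathcal{K}_n=\{f\in\mathbb{K}[x]\mid\nu_Q(f)<\nu(f)\text{ for all }Q\in\Psi_n\}$. A limit key polynomial for $\Psi_n$ is a monic polynomial $Q_n\in\mathcal{K}_n$ of least degree among the polynomials in $\mathcal{K}_n$; it is a key polynomial for $\nu$. Graded ring: for a valuation $\nu$ on $\mathbb{K}[x]$ and $\gamma\in\nu(\mathbb{K}[x]\setminus\mathrm{supp}(\nu))$ let $\mathcal{P}_\gamma=\{f\mid\nu(f)\ge\gamma\}$, $\mathcal{P}_\gamma^+=\{f\mid\nu(f)>\gamma\}$; then $\mathcal{G}_\nu=\bigoplus_\gamma\mathcal{P}_\gamma/\mathcal{P}_\gamma^+$, with product extending $(f+\mathcal{P}_\beta^+)(g+\mathcal{P}_\gamma^+)=fg+\mathcal{P}_{\beta+\gamma}^+$ for $\nu(f)=\beta$, $\nu(g)=\gamma$. For $f\notin\mathrm{supp}(\nu)$, $\mathrm{in}_\nu(f)$ is the image of $f$ in $\mathcal{P}_{\nu(f)}/\mathcal{P}_{\nu(f)}^+$; for $f\in\mathrm{supp}(\nu)$, $\mathrm{in}_\nu(f)=0$. For a key polynomial $Q$ for $\nu$, write $\mathcal{G}_Q=\mathcal{G}_{\nu_Q}$ and $\mathrm{in}_Q=\mathrm{in}_{\nu_Q}$.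 On $\Psi_n$ put $Q\preceq Q'$ iff $\nu_Q\le\nu_{Q'}$; this is a total preorder, so $\Psi_n$ is directed. For $Q\preceq Q'$, $\phi_{QQ'}:\mathcal{G}_Q\to\mathcal{G}_{Q'}$ is the (well-defined) ring homomorphism obtained by additive extension from $\mathrm{in}_Q(f)\mapsto\mathrm{in}_{Q'}(f)$ if $\nu_Q(f)=\nu_{Q'}(f)$ and $\mathrm{in}_Q(f)\mapsto0$ if $\nu_Q(f)<\nu_{Q'}(f)$. These maps form a direct system over $\Psi_n$.
   Formalization: The second isomorphism, G_{Q_n} ≅ (lim G_Q)[Y], is stated only when ν(Q_n) is finite; if Q_n lies in supp(ν) it fails, e.g. ν(f)=v_7(f(√2)) on ℚ[x], n=1, Q_1=x²−2, where G_{Q_1}=lim G_Q=F_7[T,1/T]. *)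

theory Defs
  imports "HOL-Algebra.Algebra" "HOL-Algebra.Algebraic_Closure_Type" "HOL-Library.Extended"
begin

section \<open>Valuations\<close>

text \<open>The set \<open>\<Gamma> \<union> {\<infinity>}\<close> is the part of \<^typ>\<open>'g extended\<close> that excludes \<open>-\<infinity>\<close>; the element \<open>-\<infinity>\<close> is
  only used as the value of \<open>\<delta>\<close> on constants.\<close>

definition valuation :: "('a::comm_ring_1 \<Rightarrow> 'g::linordered_ab_group_add extended) \<Rightarrow> bool" where
  "valuation \<nu> \<longleftrightarrow>
     (\<forall>a. \<nu> a \<noteq> -\<infinity>) \<and>
     (\<forall>a b. \<nu> (a * b) = \<nu> a + \<nu> b) \<and>
     (\<forall>a b. min (\<nu> a) (\<nu> b) \<le> \<nu> (a + b)) \<and>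
     \<nu> 1 = 0 \<and> \<nu> 0 = \<infinity>"

definition supp :: "('a \<Rightarrow> 'g extended) \<Rightarrow> 'a set" where
  "supp \<nu> = {a. \<nu> a = \<infinity>}"


section \<open>Key polynomials\<close>

definition root_level ::
    "('k::field alg_closure poly \<Rightarrow> 'g::linordered_ab_group_add extended) \<Rightarrow> 'k poly \<Rightarrow> 'g extended"
    (\<open>\<delta>\<close>) where
  "\<delta> \<nu>bar f =
     (if 0 < Polynomial.degree f
      then Max {\<nu>bar [:- a, 1:] |a. poly (map_poly to_ac f) a = 0}
      else -\<infinity>)"

text \<open>\<open>Q\<close> is a key polynomial for the valuation \<open>\<nu>\<close> on \<^typ>\<open>'k poly\<close> that \<open>\<nu>bar\<close> extends. The choice
  of the extension \<open>\<nu>bar\<close> of \<open>\<nu>\<close> does not matter.\<close>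

definition key_poly ::
    "('k::field alg_closure poly \<Rightarrow> 'g::linordered_ab_group_add extended) \<Rightarrow> 'k poly \<Rightarrow> bool" where
  "key_poly \<nu>bar Q \<longleftrightarrow>
     lead_coeff Q = 1 \<and>
     (\<forall>f. f \<noteq> 0 \<longrightarrow> \<delta> \<nu>bar Q \<le> \<delta> \<nu>bar f \<longrightarrow> Polynomial.degree Q \<le> Polynomial.degree f)"

definition key_polys ::
    "('k::field alg_closure poly \<Rightarrow> 'g::linordered_ab_group_add extended) \<Rightarrow> nat \<Rightarrow> 'k poly set"
    (\<open>\<Psi>\<close>) where
  "\<Psi> \<nu>bar n = {Q. key_poly \<nu>bar Q \<and> Polynomial.degree Q = n}"


section \<open>Truncations and limit key polynomials\<close>

text \<open>For a non-constant \<open>q\<close>, the \<open>q\<close>-expansion \<open>f = f\<^sub>0 + f\<^sub>1 q + \<dots> + f\<^sub>s q\<^sup>s\<close> is recorded as the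
  polynomial \<open>F = f\<^sub>0 + f\<^sub>1 Y + \<dots> + f\<^sub>s Y\<^sup>s\<close> with polynomial coefficients, so that \<open>f = F(q)\<close>.\<close>

definition q_expansion :: "'k::field poly \<Rightarrow> 'k poly \<Rightarrow> 'k poly poly" where
  "q_expansion q f =
     (THE F. poly F q = f \<and>
             (\<forall>i. Polynomial.degree (Polynomial.coeff F i) < Polynomial.degree q))"

definition truncation ::
    "('k::field poly \<Rightarrow> 'g::linordered_ab_group_add extended) \<Rightarrow> 'k poly \<Rightarrow> 'k poly \<Rightarrow> 'g extended" where
  "truncation \<nu> q f =
     (let F = q_expansion q f
      in Min ((\<lambda>i. \<nu> (Polynomial.coeff F i * q ^ i)) ` {0..Polynomial.degree F}))"

definition limit_candidates ::
    "('k::field poly \<Rightarrow> 'g::linordered_ab_group_add extended) \<Rightarrow> 'k poly set \<Rightarrow> 'k poly set" where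
  "limit_candidates \<nu> S = {f. \<forall>Q\<in>S. truncation \<nu> Q f < \<nu> f}"

definition limit_key_poly ::
    "('k::field poly \<Rightarrow> 'g::linordered_ab_group_add extended) \<Rightarrow> 'k poly set \<Rightarrow> 'k poly \<Rightarrow> bool" where
  "limit_key_poly \<nu> S q \<longleftrightarrow>
     lead_coeff q = 1 \<and> q \<in> limit_candidates \<nu> S \<and>
     (\<forall>f\<in>limit_candidates \<nu> S. Polynomial.degree q \<le> Polynomial.degree f)"


section \<open>The graded ring of a valuation\<close>

definition value_index :: "('a \<Rightarrow> 'g extended) \<Rightarrow> 'g set" where
  "value_index \<nu> = {\<gamma>. \<exists>f. f \<notin> supp \<nu> \<and> \<nu> f = Fin \<gamma>}"

definition P_ge :: "('a \<Rightarrow> 'g::linordered_ab_group_add extended) \<Rightarrow> 'g \<Rightarrow> 'a set" where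
  "P_ge \<nu> \<gamma> = {f. Fin \<gamma> \<le> \<nu> f}"

definition P_gt :: "('a \<Rightarrow> 'g::linordered_ab_group_add extended) \<Rightarrow> 'g \<Rightarrow> 'a set" where
  "P_gt \<nu> \<gamma> = {f. Fin \<gamma> < \<nu> f}"

text \<open>The quotient of the additive group \<open>P\<^sub>\<gamma>\<close> by \<open>P\<^sub>\<gamma>\<^sup>+\<close>; as HOL-Algebra groups are multiplicative
  records, its neutral element \<open>P\<^sub>\<gamma>\<^sup>+\<close> is written \<open>\<one>\<close>.\<close>

definition graded_component ::
    "('a::comm_ring_1 \<Rightarrow> 'g::linordered_ab_group_add extended) \<Rightarrow> 'g \<Rightarrow> 'a set monoid" where
  "graded_component \<nu> \<gamma> =
     \<lparr>carrier = P_ge \<nu> \<gamma>, monoid.mult = (+), monoid.one = 0\<rparr> Mod P_gt \<nu> \<gamma>"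

text \<open>The product of the classes \<open>A = f + P\<^sub>\<beta>\<^sup>+\<close> and \<open>B = g + P\<^sub>\<gamma>\<^sup>+\<close> as the class \<open>f g + P\<^sub>\<epsilon>\<^sup>+\<close>,
  where \<open>\<epsilon> = \<beta> + \<gamma>\<close>.\<close>

definition class_mult ::
    "('a::comm_ring_1 \<Rightarrow> 'g::linordered_ab_group_add extended) \<Rightarrow> 'g \<Rightarrow> 'a set \<Rightarrow> 'a set \<Rightarrow> 'a set" where
  "class_mult \<nu> \<epsilon> A B = {f * g + h |f g h. f \<in> A \<and> g \<in> B \<and> h \<in> P_gt \<nu> \<epsilon>}"

definition initial_form ::
    "('a::comm_ring_1 \<Rightarrow> 'g::linordered_ab_group_add extended) \<Rightarrow> 'a \<Rightarrow> 'g \<Rightarrow> 'a set" where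
  "initial_form \<nu> f =
     (\<lambda>\<gamma>\<in>value_index \<nu>. if \<nu> f = Fin \<gamma> then {f + h |h. h \<in> P_gt \<nu> \<gamma>} else P_gt \<nu> \<gamma>)"

text \<open>The sum defining the \<open>\<epsilon>\<close>-component of a product only ranges over the pairs of non-zero
  components, since \<^const>\<open>finprod\<close> is meaningful for finite index sets only.\<close>

definition graded_ring ::
    "('a::comm_ring_1 \<Rightarrow> 'g::linordered_ab_group_add extended) \<Rightarrow> ('g \<Rightarrow> 'a set) ring" where
  "graded_ring \<nu> =
     (let D = sum_group (value_index \<nu>) (graded_component \<nu>) in
      \<lparr>carrier = carrier D,
       monoid.mult = (\<lambda>x y. \<lambda>\<epsilon>\<in>value_index \<nu>.
          finprod (graded_component \<nu> \<epsilon>) (\<lambda>(\<beta>, \<gamma>). class_mult \<nu> \<epsilon> (x \<beta>) (y \<gamma>))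
            {(\<beta>, \<gamma>). \<beta> \<in> value_index \<nu> \<and> \<gamma> \<in> value_index \<nu> \<and> \<beta> + \<gamma> = \<epsilon> \<and>
                     x \<beta> \<noteq> P_gt \<nu> \<beta> \<and> y \<gamma> \<noteq> P_gt \<nu> \<gamma>}),
       monoid.one = initial_form \<nu> 1,
       ring.zero = \<one>\<^bsub>D\<^esub>,
       ring.add = monoid.mult D\<rparr>)"

text \<open>The subring \<open>R\<^sub>Q\<close> of the graded ring of the truncation at \<open>Q\<close>, as a ring in its own right.\<close>

definition low_degree_ring ::
    "('k::field poly \<Rightarrow> 'g::linordered_ab_group_add extended) \<Rightarrow> 'k poly \<Rightarrow> ('g \<Rightarrow> 'k poly set) ring" where
  "low_degree_ring \<nu> Q =
     (graded_ring (truncation \<nu> Q))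
       \<lparr>carrier := generate (add_monoid (graded_ring (truncation \<nu> Q)))
          (initial_form (truncation \<nu> Q) ` {f. Polynomial.degree f < Polynomial.degree Q})\<rparr>"

text \<open>The additive map between graded rings with prescribed values on initial forms. It is unique
  on the carrier because initial forms generate the graded ring additively; outside the carrier it
  is fixed to be \<^const>\<open>undefined\<close>.\<close>

definition graded_map ::
    "('a::comm_ring_1 \<Rightarrow> 'g::linordered_ab_group_add extended) \<Rightarrow> ('a \<Rightarrow> 'g extended)
      \<Rightarrow> ('g \<Rightarrow> 'a set) \<Rightarrow> ('g \<Rightarrow> 'a set)" where
  "graded_map \<mu> \<mu>' =
     (THE \<phi>. \<phi> \<in> extensional (carrier (graded_ring \<mu>)) \<and>
             \<phi> \<in> hom (add_monoid (graded_ring \<mu>)) (add_monoid (graded_ring \<mu>')) \<and>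
             (\<forall>f. (\<mu> f = \<mu>' f \<longrightarrow> \<phi> (initial_form \<mu> f) = initial_form \<mu>' f) \<and>
                  (\<mu> f < \<mu>' f \<longrightarrow> \<phi> (initial_form \<mu> f) = \<zero>\<^bsub>graded_ring \<mu>'\<^esub>)))"


section \<open>Direct limits of rings\<close>

text \<open>The direct limit of a direct system of rings \<open>R i\<close> with transition maps \<open>\<phi> i j\<close> for \<open>leq i j\<close>
  over an index set \<open>I\<close> directed by \<open>leq\<close>: the disjoint union of the carriers modulo the relation
  of becoming equal at some later stage.\<close>

definition dirlim_rel ::
    "'i set \<Rightarrow> ('i \<Rightarrow> 'i \<Rightarrow> bool) \<Rightarrow> ('i \<Rightarrow> ('a, 'm) ring_scheme) \<Rightarrow> ('i \<Rightarrow> 'i \<Rightarrow> 'a \<Rightarrow> 'a)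
      \<Rightarrow> (('i \<times> 'a) \<times> ('i \<times> 'a)) set" where
  "dirlim_rel I leq R \<phi> =
     {((i, x), (j, y)) |i x j y.
        i \<in> I \<and> j \<in> I \<and> x \<in> carrier (R i) \<and> y \<in> carrier (R j) \<and>
        (\<exists>k\<in>I. leq i k \<and> leq j k \<and> \<phi> i k x = \<phi> j k y)}"

definition dirlim ::
    "'i set \<Rightarrow> ('i \<Rightarrow> 'i \<Rightarrow> bool) \<Rightarrow> ('i \<Rightarrow> ('a, 'm) ring_scheme) \<Rightarrow> ('i \<Rightarrow> 'i \<Rightarrow> 'a \<Rightarrow> 'a)
      \<Rightarrow> ('i \<times> 'a) set ring" where
  "dirlim I leq R \<phi> =
     (let E = dirlim_rel I leq R \<phi> in
      \<lparr>carrier = (SIGMA i:I. carrier (R i)) // E,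
       monoid.mult = (\<lambda>A B. E `` {(k, \<phi> i k x \<otimes>\<^bsub>R k\<^esub> \<phi> j k y) |i x j y k.
          (i, x) \<in> A \<and> (j, y) \<in> B \<and> k \<in> I \<and> leq i k \<and> leq j k}),
       monoid.one = E `` {(i, \<one>\<^bsub>R i\<^esub>) |i. i \<in> I},
       ring.zero = E `` {(i, \<zero>\<^bsub>R i\<^esub>) |i. i \<in> I},
       ring.add = (\<lambda>A B. E `` {(k, \<phi> i k x \<oplus>\<^bsub>R k\<^esub> \<phi> j k y) |i x j y k.
          (i, x) \<in> A \<and> (j, y) \<in> B \<and> k \<in> I \<and> leq i k \<and> leq j k})\<rparr>)"

definition truncation_limit ::
    "('k::field poly \<Rightarrow> 'g::linordered_ab_group_add extended) \<Rightarrow> 'k poly set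
      \<Rightarrow> ('k poly \<times> ('g \<Rightarrow> 'k poly set)) set ring" where
  "truncation_limit \<nu> S =
     dirlim S (\<lambda>Q Q'. truncation \<nu> Q \<le> truncation \<nu> Q')
       (\<lambda>Q. graded_ring (truncation \<nu> Q))
       (\<lambda>Q Q'. graded_map (truncation \<nu> Q) (truncation \<nu> Q'))"

end

theory Submission
  imports Defs "HOL-Library.Poly_Mapping"
begin

text \<open>All rings in the theorem are quotients of rings of representatives, and the proof compares
  kernels. For a valuation \<open>\<mu>\<close> consider the finitely supported families \<open>r\<close>, indexed by \<open>\<Gamma>\<close>, of
  polynomials with \<open>\<mu> (r \<gamma>) \<ge> \<gamma>\<close>. They form a subring of the group ring of \<open>\<Gamma>\<close> over \<open>\<bbbK>[x]\<close>, the Rees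
  ring of \<open>\<mu>\<close>, and \<open>\<G>\<^sub>\<mu>\<close> is its quotient by the families with \<open>\<mu> (r \<gamma>) > \<gamma>\<close> for all \<open>\<gamma>\<close>. If
  \<open>\<mu> \<le> \<mu>'\<close> then the Rees ring of \<open>\<mu>\<close> is contained in that of \<open>\<mu>'\<close>, and the map \<open>\<G>\<^sub>\<mu> \<rightarrow> \<G>\<^sub>\<mu>\<^sub>'\<close> sends a
  class to the class of the same family (\<open>graded_map_class\<close>). Hence the direct limit over \<open>\<Psi>\<^sub>n\<close> is the
  union \<open>U\<close> of the Rees rings modulo the union of the kernels (\<open>limit_presentation\<close>), and since
  \<open>\<nu>\<^sub>Q \<le> \<nu>\<^sub>Q\<^sub>n\<close> for \<open>Q\<close> in \<open>\<Psi>\<^sub>n\<close>, the ring \<open>U\<close> also maps to the graded ring at the limit key polynomial.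
  It remains to see that both maps on \<open>U\<close> have the same kernel and that the second one has the image
  \<open>R\<^sub>Q\<^sub>n\<close>.

  Both rest on one property of a key polynomial \<open>q\<close>: if \<open>u\<close> and \<open>v\<close> have degree below that of \<open>q\<close>,
  then the quotient part of the division of \<open>u v\<close> by \<open>q\<close> has a value larger than \<open>\<nu> (u v)\<close>
  (locale \<open>abstract_key_poly\<close>). For key polynomials in the sense of \<open>\<delta>\<close> this holds because \<open>u\<close>, \<open>v\<close> and the
  remainder are, up to terms of higher value, equal to their values at a root of \<open>q\<close> closest to the
  generic point (\<open>key_poly_imp_abstract\<close>). For a limit key polynomial it follows from the minimality of
  its degree (\<open>key_Qn\<close>). The property implies that the truncation is a valuation. It also implies that
  every \<open>f\<close> with \<open>\<nu>\<^sub>Q f \<ge> \<gamma>\<close> is congruent, up to values above \<open>\<gamma>\<close> under \<open>\<nu>\<^sub>q\<close>, to a polynomial of degree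
  below that of \<open>q\<close> whenever \<open>q\<close> lies beyond \<open>Q\<close> (\<open>lower_imp_near\<close>). Taking for \<open>q\<close> the limit key polynomial, this
  gives the image; taking for \<open>q\<close> a later member of \<open>\<Psi>\<^sub>n\<close>, it shows that the truncated value of \<open>f\<close>
  exceeds \<open>\<gamma>\<close> as soon as \<open>\<nu> f\<close> does (\<open>tr_gt_if_value_gt\<close>), which gives the kernel.

  Finally, \<open>\<nu>\<^sub>Q\<^sub>n\<close> is computed digit by digit from the \<open>Q\<^sub>n\<close>-expansion. So if \<open>Q\<^sub>n\<close> has a
  finite value, its initial form is transcendental over \<open>R\<^sub>Q\<^sub>n\<close> and generates the graded ring over it
  (\<open>graded_ring_iso_polynomials\<close>).\<close>


section \<open>Presentations of rings by representatives\<close>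

text \<open>The representatives live in a subring of a type of class \<open>comm_ring_1\<close>, so that ring laws of the
  presented record are inherited from the type.\<close>

locale ring_presentation =
  fixes A :: "'r::comm_ring_1 set" and \<pi> :: "'r \<Rightarrow> 'a" and G :: "('a, 'm) ring_scheme"
  assumes one_in: "1 \<in> A"
    and diff_in: "\<And>r s. r \<in> A \<Longrightarrow> s \<in> A \<Longrightarrow> r - s \<in> A"
    and mult_in: "\<And>r s. r \<in> A \<Longrightarrow> s \<in> A \<Longrightarrow> r * s \<in> A"
    and carrier_eq: "carrier G = \<pi> ` A"
    and add_eq: "\<And>r s. r \<in> A \<Longrightarrow> s \<in> A \<Longrightarrow> \<pi> (r + s) = \<pi> r \<oplus>\<^bsub>G\<^esub> \<pi> s"
    and mult_eq: "\<And>r s. r \<in> A \<Longrightarrow> s \<in> A \<Longrightarrow> \<pi> (r * s) = \<pi> r \<otimes>\<^bsub>G\<^esub> \<pi> s"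
    and one_eq: "\<pi> 1 = \<one>\<^bsub>G\<^esub>"
    and zero_eq: "\<pi> 0 = \<zero>\<^bsub>G\<^esub>"
begin

lemma zero_in: "0 \<in> A"
  using diff_in[OF one_in one_in] by simp

lemma uminus_in: "r \<in> A \<Longrightarrow> - r \<in> A"
  using diff_in[OF zero_in, of r] by simp

lemma add_in: "r \<in> A \<Longrightarrow> s \<in> A \<Longrightarrow> r + s \<in> A"
  using diff_in[OF _ uminus_in, of r s] by simp

lemma power_in: "r \<in> A \<Longrightarrow> r ^ i \<in> A"
  by (induct i) (auto intro: one_in mult_in)

lemma sum_in: "(\<And>i. i \<in> I \<Longrightarrow> f i \<in> A) \<Longrightarrow> sum f I \<in> A"
  by (induct I rule: infinite_finite_induct) (auto intro: zero_in add_in)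

lemma closed: "r \<in> A \<Longrightarrow> \<pi> r \<in> carrier G"
  by (simp add: carrier_eq)

lemma is_cring: "cring G"
proof (rule cringI)
  show "abelian_group G"
  proof (rule abelian_groupI)
    fix x assume "x \<in> carrier G"
    then obtain r where r: "r \<in> A" "x = \<pi> r" by (auto simp: carrier_eq)
    have "\<pi> (- r) \<oplus>\<^bsub>G\<^esub> x = \<zero>\<^bsub>G\<^esub>"
      using add_eq[OF uminus_in, OF r(1) r(1)] by (simp add: r(2) zero_eq)
    then show "\<exists>y\<in>carrier G. y \<oplus>\<^bsub>G\<^esub> x = \<zero>\<^bsub>G\<^esub>"
      using closed[OF uminus_in[OF r(1)]] by blast
  qed (auto simp: carrier_eq add_eq[symmetric] zero_eq[symmetric] add_in zero_in algebra_simps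
      intro!: imageI)
  show "comm_monoid G"
    by (rule comm_monoidI)
      (auto simp: carrier_eq mult_eq[symmetric] one_eq[symmetric] mult_in one_in algebra_simps
        intro!: imageI)
qed (auto simp: carrier_eq add_eq[symmetric] mult_eq[symmetric] mult_in add_in algebra_simps)

lemma diff_zero_iff:
  assumes "r \<in> A" "s \<in> A"
  shows "\<pi> (r - s) = \<zero>\<^bsub>G\<^esub> \<longleftrightarrow> \<pi> r = \<pi> s"
proof -
  interpret cring G by (rule is_cring)
  have "\<pi> r = \<pi> (r - s) \<oplus>\<^bsub>G\<^esub> \<pi> s"
    using add_eq[OF diff_in, OF assms assms(2)] by simp
  then show ?thesis
    using closed[OF assms(2)] closed[OF diff_in[OF assms]] add.l_cancel_one by force
qed

lemma sum_eq:
  assumes "\<And>i. i \<in> I \<Longrightarrow> f i \<in> A"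
  shows "\<pi> (sum f I) = finsum G (\<lambda>i. \<pi> (f i)) I"
proof -
  interpret cring G by (rule is_cring)
  show ?thesis
    using assms
  proof (induct I rule: infinite_finite_induct)
    case (insert i I)
    then have "(\<lambda>i. \<pi> (f i)) \<in> I \<rightarrow> carrier G" using closed by auto
    with insert show ?case using closed by (simp add: add_eq sum_in)
  qed (simp_all add: zero_eq)
qed

lemma power_eq:
  assumes "r \<in> A"
  shows "\<pi> (r ^ i) = \<pi> r [^]\<^bsub>G\<^esub> i"
proof -
  interpret cring G by (rule is_cring)
  show ?thesis
  proof (induct i)
    case (Suc i)
    have "\<pi> (r ^ Suc i) = \<pi> (r ^ i) \<otimes>\<^bsub>G\<^esub> \<pi> r"
      using mult_eq[OF power_in assms, OF assms] by (simp add: mult.commute)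
    with Suc show ?case by simp
  qed (simp add: one_eq)
qed

text \<open>The first isomorphism theorem, for two presentations whose rings of representatives are
  nested: the map of the quotients sends a class to the class of the same representative.\<close>

lemma induced_hom:
  assumes "ring_presentation B \<pi>' H" and "A \<subseteq> B"
    and ker: "\<And>r. r \<in> A \<Longrightarrow> \<pi> r = \<zero>\<^bsub>G\<^esub> \<Longrightarrow> \<pi>' r = \<zero>\<^bsub>H\<^esub>"
  obtains h where "h \<in> ring_hom G H" "\<And>r. r \<in> A \<Longrightarrow> h (\<pi> r) = \<pi>' r"
proof
  interpret B: ring_presentation B \<pi>' H by fact
  define h where "h x = \<pi>' (SOME r. r \<in> A \<and> \<pi> r = x)" for x
  show h: "h (\<pi> r) = \<pi>' r" if "r \<in> A" for r
  proof -
    define s where "s = (SOME s. s \<in> A \<and> \<pi> s = \<pi> r)"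
    have "s \<in> A \<and> \<pi> s = \<pi> r"
      unfolding s_def by (rule someI[of _ r]) (use that in auto)
    with that show ?thesis
      using B.diff_zero_iff[of s r] diff_zero_iff[of s r] ker[of "s - r"] diff_in[of s r] \<open>A \<subseteq> B\<close>
      unfolding h_def s_def[symmetric] by auto
  qed
  show "h \<in> ring_hom G H"
    using \<open>A \<subseteq> B\<close>
    by (intro ring_hom_memI)
      (auto simp: carrier_eq B.carrier_eq h B.add_eq B.mult_eq add_in mult_in one_in subset_iff
        B.one_eq one_eq[symmetric] add_eq[symmetric] mult_eq[symmetric])
qed

lemma isomorphic:
  assumes "ring_presentation A \<pi>' H"
    and ker: "\<And>r. r \<in> A \<Longrightarrow> \<pi> r = \<zero>\<^bsub>G\<^esub> \<longleftrightarrow> \<pi>' r = \<zero>\<^bsub>H\<^esub>"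
  shows "G \<simeq> H"
proof -
  interpret B: ring_presentation A \<pi>' H by fact
  obtain h where h: "h \<in> ring_hom G H" and h_eq: "\<And>r. r \<in> A \<Longrightarrow> h (\<pi> r) = \<pi>' r"
    using induced_hom[OF assms(1)] ker by blast
  have "inj_on h (carrier G)"
    by (rule inj_onI)
      (auto simp: carrier_eq h_eq diff_zero_iff[symmetric] B.diff_zero_iff[symmetric] ker diff_in)
  moreover have "h ` carrier G = carrier H"
    by (auto simp: carrier_eq B.carrier_eq h_eq image_image)
  ultimately show ?thesis
    using h unfolding is_ring_iso_def ring_iso_def bij_betw_def by blast
qed

end


section \<open>Direct limits of presented rings\<close>

text \<open>All stages have representatives in one common ring and the transition maps keep the
  representative. The limit is then the union of the rings of representatives, and a representative
  becomes zero if it does so at some stage.\<close>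

locale presented_system =
  fixes I :: "'i set" and leq :: "'i \<Rightarrow> 'i \<Rightarrow> bool" and R :: "'i \<Rightarrow> ('a, 'm) ring_scheme"
    and \<phi> :: "'i \<Rightarrow> 'i \<Rightarrow> 'a \<Rightarrow> 'a" and A :: "'i \<Rightarrow> 'r::comm_ring_1 set" and \<pi> :: "'i \<Rightarrow> 'r \<Rightarrow> 'a"
  assumes nonempty: "I \<noteq> {}"
    and leq_refl: "\<And>i. leq i i"
    and leq_trans: "\<And>i j k. leq i j \<Longrightarrow> leq j k \<Longrightarrow> leq i k"
    and directed: "\<And>i j. i \<in> I \<Longrightarrow> j \<in> I \<Longrightarrow> \<exists>k\<in>I. leq i k \<and> leq j k"
    and presents: "\<And>i. i \<in> I \<Longrightarrow> ring_presentation (A i) (\<pi> i) (R i)"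
    and A_mono: "\<And>i j. i \<in> I \<Longrightarrow> j \<in> I \<Longrightarrow> leq i j \<Longrightarrow> A i \<subseteq> A j"
    and transition: "\<And>i j r. i \<in> I \<Longrightarrow> j \<in> I \<Longrightarrow> leq i j \<Longrightarrow> r \<in> A i \<Longrightarrow> \<phi> i j (\<pi> i r) = \<pi> j r"
begin

abbreviation "E \<equiv> dirlim_rel I leq R \<phi>"

text \<open>Pairs from every stage that knows \<open>r\<close> are collected; they all lie in one equivalence class.\<close>

definition limit_class :: "'r \<Rightarrow> ('i \<times> 'a) set" where
  "limit_class r = E `` {(i, \<pi> i r) |i. i \<in> I \<and> r \<in> A i}"

lemma rel_iff:
  assumes "i \<in> I" "j \<in> I" "r \<in> A i" "s \<in> A j"
  shows "((i, \<pi> i r), (j, \<pi> j s)) \<in> E \<longleftrightarrow> (\<exists>k\<in>I. leq i k \<and> leq j k \<and> \<pi> k r = \<pi> k s)"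
proof -
  have "\<pi> i r \<in> carrier (R i)" "\<pi> j s \<in> carrier (R j)"
    using ring_presentation.closed[OF presents] assms by blast+
  then show ?thesis
    using assms transition by (simp add: dirlim_rel_def cong: bex_cong conj_cong)
qed

lemma eq_above:
  assumes "i \<in> I" "j \<in> I" "leq i j" "r \<in> A i" "s \<in> A i" "\<pi> i r = \<pi> i s"
  shows "\<pi> j r = \<pi> j s"
  using transition[OF assms(1-4)] transition[OF assms(1-3,5)] assms(6) by simp

lemma field_cases:
  assumes "p \<in> (SIGMA i:I. carrier (R i))"
  obtains i r where "i \<in> I" "r \<in> A i" "p = (i, \<pi> i r)"
proof -
  obtain i x where i: "i \<in> I" "x \<in> carrier (R i)" "p = (i, x)"
    using assms by blast
  then obtain r where "r \<in> A i" "x = \<pi> i r"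
    using ring_presentation.carrier_eq[OF presents[OF i(1)]] by blast
  with i that show thesis by blast
qed

lemma equiv_E: "equiv (SIGMA i:I. carrier (R i)) E"
proof (rule equivI)
  show "E \<subseteq> (SIGMA i:I. carrier (R i)) \<times> (SIGMA i:I. carrier (R i))"
    by (auto simp: dirlim_rel_def)
  show "refl_on (SIGMA i:I. carrier (R i)) E"
    by (rule refl_onI) (use leq_refl in \<open>auto simp: dirlim_rel_def intro!: bexI\<close>)
  show "sym E"
    by (rule symI) (auto simp: dirlim_rel_def, metis)
  show "trans E"
  proof (rule transI)
    fix p q t assume pq: "(p, q) \<in> E" and qt: "(q, t) \<in> E"
    have "p \<in> (SIGMA i:I. carrier (R i))" "q \<in> (SIGMA i:I. carrier (R i))"
      "t \<in> (SIGMA i:I. carrier (R i))"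
      using pq qt by (auto simp: dirlim_rel_def)
    then obtain i r j s l u where p: "i \<in> I" "r \<in> A i" "p = (i, \<pi> i r)"
      and q: "j \<in> I" "s \<in> A j" "q = (j, \<pi> j s)" and t: "l \<in> I" "u \<in> A l" "t = (l, \<pi> l u)"
      by (metis field_cases)
    obtain k where k: "k \<in> I" "leq i k" "leq j k" "\<pi> k r = \<pi> k s"
      using pq p q rel_iff by auto
    obtain k' where k': "k' \<in> I" "leq j k'" "leq l k'" "\<pi> k' s = \<pi> k' u"
      using qt q t rel_iff by auto
    obtain m where m: "m \<in> I" "leq k m" "leq k' m" using directed k(1) k'(1) by blast
    have "r \<in> A k" "s \<in> A k" "s \<in> A k'" "u \<in> A k'"
      using A_mono p q t k k' by blast+
    then have "\<pi> m r = \<pi> m u"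
      using eq_above[OF k(1) m(1,2)] eq_above[OF k'(1) m(1,3)] k(4) k'(4) by metis
    moreover have "leq i m" "leq l m" using leq_trans k k' m by blast+
    ultimately show "(p, t) \<in> E" using rel_iff p t m(1) by auto
  qed
qed

lemma limit_class_eq:
  assumes "i \<in> I" "r \<in> A i"
  shows "limit_class r = E `` {(i, \<pi> i r)}"
proof -
  have "E `` {(j, \<pi> j r)} = E `` {(i, \<pi> i r)}" if "j \<in> I" "r \<in> A j" for j
  proof (rule equiv_class_eq[OF equiv_E])
    show "((j, \<pi> j r), (i, \<pi> i r)) \<in> E"
      using directed[OF assms(1) that(1)] rel_iff[OF that(1) assms(1) that(2) assms(2)] by blast
  qed
  then have "E `` {(j, \<pi> j r) |j. j \<in> I \<and> r \<in> A j} = E `` {(i, \<pi> i r)}"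
    using assms by blast
  then show ?thesis by (simp add: limit_class_def)
qed

lemma limit_class_eq_iff:
  assumes "i \<in> I" "j \<in> I" "r \<in> A i" "s \<in> A j"
  shows "limit_class r = limit_class s \<longleftrightarrow> (\<exists>k\<in>I. leq i k \<and> leq j k \<and> \<pi> k r = \<pi> k s)"
proof -
  have "(i, \<pi> i r) \<in> (SIGMA i:I. carrier (R i))" "(j, \<pi> j s) \<in> (SIGMA i:I. carrier (R i))"
    using assms ring_presentation.closed[OF presents] by auto
  then show ?thesis
    unfolding limit_class_eq[OF assms(1,3)] limit_class_eq[OF assms(2,4)]
    using eq_equiv_class_iff[OF equiv_E] rel_iff[OF assms] by auto
qed

lemma limit_class_mem:
  assumes "i \<in> I" "r \<in> A i"
  shows "(j, x) \<in> limit_class r \<longleftrightarrow>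
    (\<exists>s\<in>A j. j \<in> I \<and> x = \<pi> j s \<and> (\<exists>k\<in>I. leq i k \<and> leq j k \<and> \<pi> k r = \<pi> k s))"
    (is "_ \<longleftrightarrow> ?rhs")
proof
  assume "(j, x) \<in> limit_class r"
  then have E: "((i, \<pi> i r), (j, x)) \<in> E" using limit_class_eq[OF assms] by auto
  then have "(j, x) \<in> (SIGMA i:I. carrier (R i))" by (auto simp: dirlim_rel_def)
  then obtain s where "j \<in> I" "s \<in> A j" "x = \<pi> j s" using field_cases by blast
  with E show ?rhs using rel_iff[OF assms(1) _ assms(2)] by auto
next
  assume ?rhs
  then show "(j, x) \<in> limit_class r"
    using limit_class_eq[OF assms] rel_iff[OF assms(1) _ assms(2)] by auto
qed

text \<open>The operations of the direct limit take all representatives of both classes at all common later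
  stages. These results fall into a single class because any two choices of representatives agree
  from some stage on.\<close>

lemma limit_operation:
  assumes ij: "i \<in> I" "j \<in> I" "r \<in> A i" "s \<in> A j"
    and closed: "\<And>k r s. k \<in> I \<Longrightarrow> r \<in> A k \<Longrightarrow> s \<in> A k \<Longrightarrow> op r s \<in> A k"
    and op: "\<And>k r s. k \<in> I \<Longrightarrow> r \<in> A k \<Longrightarrow> s \<in> A k \<Longrightarrow> \<pi> k (op r s) = op' k (\<pi> k r) (\<pi> k s)"
  shows "E `` {(k, op' k (\<phi> i' k x) (\<phi> j' k y)) |i' x j' y k.
      (i', x) \<in> limit_class r \<and> (j', y) \<in> limit_class s \<and> k \<in> I \<and> leq i' k \<and> leq j' k}
    = limit_class (op r s)"
    (is "E `` ?S = _")
proof -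
  obtain k0 where k0: "k0 \<in> I" "leq i k0" "leq j k0" using directed ij by blast
  then have k0': "r \<in> A k0" "s \<in> A k0" using A_mono ij by blast+
  have "E `` {p} = limit_class (op r s)" if p_in: "p \<in> ?S" for p
  proof -
    obtain i' x j' y k where p: "p = (k, op' k (\<phi> i' k x) (\<phi> j' k y))" "(i', x) \<in> limit_class r"
      "(j', y) \<in> limit_class s" "k \<in> I" "leq i' k" "leq j' k"
      using p_in by auto
    obtain r' l where r': "r' \<in> A i'" "i' \<in> I" "x = \<pi> i' r'" "l \<in> I" "leq i l" "leq i' l"
      "\<pi> l r = \<pi> l r'"
      using p(2) limit_class_mem[OF ij(1,3)] by auto
    obtain s' l' where s': "s' \<in> A j'" "j' \<in> I" "y = \<pi> j' s'" "l' \<in> I" "leq j l'" "leq j' l'"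
      "\<pi> l' s = \<pi> l' s'"
      using p(3) limit_class_mem[OF ij(2,4)] by auto
    have k: "r' \<in> A k" "s' \<in> A k" using A_mono r' s' p by blast+
    have "p = (k, \<pi> k (op r' s'))"
      using p r' s' k by (simp add: transition op)
    then have "E `` {p} = limit_class (op r' s')"
      using limit_class_eq[of k "op r' s'"] closed p(4) k by simp
    moreover
    \<comment> \<open>all representatives that have been chosen agree from some stage \<open>m\<close> on\<close>
    obtain m where m: "m \<in> I" "leq l m" "leq l' m" "leq k0 m" "leq k m"
    proof -
      obtain a b where a: "a \<in> I" "leq l a" "leq l' a" and b: "b \<in> I" "leq k0 b" "leq k b"
        using directed[OF r'(4) s'(4)] directed[OF k0(1) p(4)] by blast
      obtain m where "m \<in> I" "leq a m" "leq b m"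
        using directed[OF a(1) b(1)] by blast
      then show thesis
        using that[of m] leq_trans[of _ a m] leq_trans[of _ b m] a b by blast
    qed
    have "r \<in> A l" "r' \<in> A l" "s \<in> A l'" "s' \<in> A l'"
      using A_mono ij r' s' by blast+
    then have rs: "\<pi> m r = \<pi> m r'" "\<pi> m s = \<pi> m s'"
      using eq_above[OF r'(4) m(1,2) _ _ r'(7)] eq_above[OF s'(4) m(1,3) _ _ s'(7)] by blast+
    have m': "r \<in> A m" "r' \<in> A m" "s \<in> A m" "s' \<in> A m"
      using A_mono[OF k0(1) m(1,4)] A_mono[OF p(4) m(1,5)] k0' k by blast+
    have "\<pi> m (op r s) = \<pi> m (op r' s')"
      unfolding op[OF m(1) m'(1,3)] op[OF m(1) m'(2,4)] rs ..
    then have "limit_class (op r s) = limit_class (op r' s')"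
      using limit_class_eq_iff[OF k0(1) p(4) closed[OF k0(1) k0'] closed[OF p(4) k]] m by blast
    ultimately show ?thesis by simp
  qed
  then have "E `` {p} = limit_class (op r s)" if "p \<in> ?S" for p
    using that by blast
  moreover have "?S \<noteq> {}"
  proof -
    have "(i, \<pi> i r) \<in> limit_class r" "(j, \<pi> j s) \<in> limit_class s"
      using limit_class_mem ij leq_refl by blast+
    then show ?thesis using k0 by blast
  qed
  ultimately show ?thesis by blast
qed

lemma limit_class_onto:
  assumes "c \<in> (SIGMA i:I. carrier (R i)) // E"
  obtains i r where "i \<in> I" "r \<in> A i" "c = limit_class r"
proof -
  obtain p where p: "p \<in> (SIGMA i:I. carrier (R i))" "c = E `` {p}"
    using assms by (auto simp: quotient_def)
  obtain i r where ir: "i \<in> I" "r \<in> A i" "p = (i, \<pi> i r)"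
    using field_cases[OF p(1)] by blast
  then show thesis
    using that p(2) limit_class_eq by simp
qed

lemma limit_presentation: "ring_presentation (\<Union>i\<in>I. A i) limit_class (dirlim I leq R \<phi>)"
proof
  obtain i0 where i0: "i0 \<in> I" using nonempty by blast
  show "1 \<in> (\<Union>i\<in>I. A i)" using ring_presentation.one_in[OF presents] i0 by blast
  fix r s assume "r \<in> (\<Union>i\<in>I. A i)" "s \<in> (\<Union>i\<in>I. A i)"
  then obtain i j where ij: "i \<in> I" "j \<in> I" "r \<in> A i" "s \<in> A j" by blast
  obtain k where k: "k \<in> I" "leq i k" "leq j k" using directed ij by blast
  then have rs: "r \<in> A k" "s \<in> A k" using A_mono ij by blast+
  show "r - s \<in> (\<Union>i\<in>I. A i)" "r * s \<in> (\<Union>i\<in>I. A i)"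
    using ring_presentation.diff_in[OF presents[OF k(1)] rs]
      ring_presentation.mult_in[OF presents[OF k(1)] rs] k(1) by blast+
  show "limit_class (r + s) = limit_class r \<oplus>\<^bsub>dirlim I leq R \<phi>\<^esub> limit_class s"
    using limit_operation[where op = "(+)" and op' = "\<lambda>k x y. x \<oplus>\<^bsub>R k\<^esub> y", OF ij
        ring_presentation.add_in[OF presents] ring_presentation.add_eq[OF presents]]
    by (simp add: dirlim_def Let_def)
  show "limit_class (r * s) = limit_class r \<otimes>\<^bsub>dirlim I leq R \<phi>\<^esub> limit_class s"
    using limit_operation[where op = "(*)" and op' = "\<lambda>k x y. x \<otimes>\<^bsub>R k\<^esub> y", OF ij
        ring_presentation.mult_in[OF presents] ring_presentation.mult_eq[OF presents]]
    by (simp add: dirlim_def Let_def)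
next
  have "{(i, \<pi> i 1) |i. i \<in> I \<and> 1 \<in> A i} = {(i, \<one>\<^bsub>R i\<^esub>) |i. i \<in> I}"
    using ring_presentation.one_in[OF presents] ring_presentation.one_eq[OF presents] by auto
  then show "limit_class 1 = \<one>\<^bsub>dirlim I leq R \<phi>\<^esub>"
    by (simp add: dirlim_def Let_def limit_class_def)
  have "{(i, \<pi> i 0) |i. i \<in> I \<and> 0 \<in> A i} = {(i, \<zero>\<^bsub>R i\<^esub>) |i. i \<in> I}"
    using ring_presentation.zero_in[OF presents] ring_presentation.zero_eq[OF presents] by auto
  then show "limit_class 0 = \<zero>\<^bsub>dirlim I leq R \<phi>\<^esub>"
    by (simp add: dirlim_def Let_def limit_class_def)
  have class_in: "limit_class r \<in> (SIGMA i:I. carrier (R i)) // E" if "i \<in> I" "r \<in> A i" for i r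
    using limit_class_eq[OF that] ring_presentation.closed[OF presents, OF that] that
    by (auto intro: quotientI)
  show "carrier (dirlim I leq R \<phi>) = limit_class ` (\<Union>i\<in>I. A i)"
  proof
    show "carrier (dirlim I leq R \<phi>) \<subseteq> limit_class ` (\<Union>i\<in>I. A i)"
      by (auto simp: dirlim_def Let_def elim!: limit_class_onto)
    show "limit_class ` (\<Union>i\<in>I. A i) \<subseteq> carrier (dirlim I leq R \<phi>)"
      using class_in by (auto simp: dirlim_def Let_def)
  qed
qed

lemma limit_class_zero_iff:
  assumes "i \<in> I" "r \<in> A i"
  shows "limit_class r = \<zero>\<^bsub>dirlim I leq R \<phi>\<^esub> \<longleftrightarrow> (\<exists>k\<in>I. leq i k \<and> \<pi> k r = \<zero>\<^bsub>R k\<^esub>)"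
proof -
  have "limit_class r = limit_class 0 \<longleftrightarrow> (\<exists>k\<in>I. leq i k \<and> leq i k \<and> \<pi> k r = \<pi> k 0)"
    using limit_class_eq_iff[OF assms(1,1,2)] ring_presentation.zero_in[OF presents[OF assms(1)]]
    by blast
  then show ?thesis
    using ring_presentation.zero_eq[OF limit_presentation] ring_presentation.zero_eq[OF presents]
    by auto
qed

end

section \<open>Valuations\<close>

lemma valuation_mult: "valuation \<nu> \<Longrightarrow> \<nu> (a * b) = \<nu> a + \<nu> b"
  and valuation_add: "valuation \<nu> \<Longrightarrow> min (\<nu> a) (\<nu> b) \<le> \<nu> (a + b)"
  and valuation_1: "valuation \<nu> \<Longrightarrow> \<nu> 1 = 0"
  and valuation_0: "valuation \<nu> \<Longrightarrow> \<nu> 0 = \<infinity>"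
  and valuation_not_Minf: "valuation \<nu> \<Longrightarrow> \<nu> a \<noteq> -\<infinity>"
  by (simp_all add: valuation_def)

lemma extended_double_eq_0:
  fixes x :: "'g::linordered_ab_group_add extended"
  shows "x + x = 0 \<longleftrightarrow> x = 0"
  by (cases x) (simp_all add: zero_extended_def)

lemma valuation_uminus:
  assumes "valuation \<nu>"
  shows "\<nu> (- a) = \<nu> a"
proof -
  have "\<nu> (-1) + \<nu> (-1) = 0"
    using valuation_mult[OF assms, of "-1" "-1"] valuation_1[OF assms] by simp
  then have "\<nu> (-1) = 0" by (simp add: extended_double_eq_0)
  then show ?thesis
    using valuation_mult[OF assms, of "-1" a] by simp
qed

lemma valuation_diff: "valuation \<nu> \<Longrightarrow> min (\<nu> a) (\<nu> b) \<le> \<nu> (a - b)"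
  using valuation_add[of \<nu> a "- b"] by (simp add: valuation_uminus)

lemma valuation_ge_add: "valuation \<nu> \<Longrightarrow> x \<le> \<nu> a \<Longrightarrow> x \<le> \<nu> b \<Longrightarrow> x \<le> \<nu> (a + b)"
  using valuation_add[of \<nu> a b] by (meson min.boundedI order_trans)

lemma valuation_ge_diff: "valuation \<nu> \<Longrightarrow> x \<le> \<nu> a \<Longrightarrow> x \<le> \<nu> b \<Longrightarrow> x \<le> \<nu> (a - b)"
  using valuation_diff[of \<nu> a b] by (meson min.boundedI order_trans)

lemma valuation_gt_add: "valuation \<nu> \<Longrightarrow> x < \<nu> a \<Longrightarrow> x < \<nu> b \<Longrightarrow> x < \<nu> (a + b)"
  using valuation_add[of \<nu> a b] by (meson min_less_iff_conj less_le_trans)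

lemma valuation_gt_diff: "valuation \<nu> \<Longrightarrow> x < \<nu> a \<Longrightarrow> x < \<nu> b \<Longrightarrow> x < \<nu> (a - b)"
  using valuation_diff[of \<nu> a b] by (meson min_less_iff_conj less_le_trans)

lemma extended_add_gt_ge:
  fixes x y :: "'g::linordered_ab_group_add extended"
  shows "Fin a < x \<Longrightarrow> Fin b \<le> y \<Longrightarrow> Fin (a + b) < x + y"
  by (cases x; cases y) (auto intro: add_less_le_mono)

lemma extended_add_ge_ge:
  fixes x y :: "'g::linordered_ab_group_add extended"
  shows "Fin a \<le> x \<Longrightarrow> Fin b \<le> y \<Longrightarrow> Fin (a + b) \<le> x + y"
  by (cases x; cases y) (auto intro: add_mono)


lemma valuation_sum:
  "valuation \<nu> \<Longrightarrow> (\<And>i. i \<in> A \<Longrightarrow> x \<le> \<nu> (f i)) \<Longrightarrow> x \<le> \<nu> (sum f A)"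
  by (induct A rule: infinite_finite_induct) (auto simp: valuation_0 valuation_ge_add)

lemma valuation_diff_eq:
  assumes "valuation \<nu>" "\<nu> a < \<nu> b"
  shows "\<nu> (a - b) = \<nu> a"
proof (rule antisym)
  show "\<nu> a \<le> \<nu> (a - b)" using valuation_ge_diff[OF assms(1)] assms(2) by fastforce
  show "\<nu> (a - b) \<le> \<nu> a"
    using valuation_gt_add[OF assms(1), of "\<nu> a" "a - b" b] assms(2) by fastforce
qed


section \<open>Graded rings as quotients of Rees rings\<close>

locale valued_ring =
  fixes \<mu> :: "'a::comm_ring_1 \<Rightarrow> 'g::linordered_ab_group_add extended"
  assumes val: "valuation \<mu>"
begin

definition coset :: "'g \<Rightarrow> 'a \<Rightarrow> 'a set" where
  "coset \<gamma> f = {f + h |h. h \<in> P_gt \<mu> \<gamma>}"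

lemma mem_coset: "x \<in> coset \<gamma> f \<longleftrightarrow> x - f \<in> P_gt \<mu> \<gamma>"
  unfolding coset_def by (auto intro: exI[of _ "x - f"])

lemma gt_imp_ge: "f \<in> P_gt \<mu> \<gamma> \<Longrightarrow> f \<in> P_ge \<mu> \<gamma>"
  by (simp add: P_gt_def P_ge_def)

lemma ge_0: "0 \<in> P_ge \<mu> \<gamma>" and gt_0: "0 \<in> P_gt \<mu> \<gamma>"
  by (simp_all add: P_ge_def P_gt_def valuation_0[OF val])

lemma ge_add: "f \<in> P_ge \<mu> \<gamma> \<Longrightarrow> g \<in> P_ge \<mu> \<gamma> \<Longrightarrow> f + g \<in> P_ge \<mu> \<gamma>"
  by (simp add: P_ge_def valuation_ge_add[OF val])

lemma ge_diff: "f \<in> P_ge \<mu> \<gamma> \<Longrightarrow> g \<in> P_ge \<mu> \<gamma> \<Longrightarrow> f - g \<in> P_ge \<mu> \<gamma>"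
  by (simp add: P_ge_def valuation_ge_diff[OF val])

lemma gt_add: "f \<in> P_gt \<mu> \<gamma> \<Longrightarrow> g \<in> P_gt \<mu> \<gamma> \<Longrightarrow> f + g \<in> P_gt \<mu> \<gamma>"
  by (simp add: P_gt_def valuation_gt_add[OF val])

lemma gt_diff: "f \<in> P_gt \<mu> \<gamma> \<Longrightarrow> g \<in> P_gt \<mu> \<gamma> \<Longrightarrow> f - g \<in> P_gt \<mu> \<gamma>"
  by (simp add: P_gt_def valuation_gt_diff[OF val])

lemma gt_uminus: "f \<in> P_gt \<mu> \<gamma> \<Longrightarrow> - f \<in> P_gt \<mu> \<gamma>"
  by (simp add: P_gt_def valuation_uminus[OF val])

lemma ge_uminus: "f \<in> P_ge \<mu> \<gamma> \<Longrightarrow> - f \<in> P_ge \<mu> \<gamma>"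
  by (simp add: P_ge_def valuation_uminus[OF val])

lemma ge_sum: "(\<And>i. i \<in> A \<Longrightarrow> f i \<in> P_ge \<mu> \<gamma>) \<Longrightarrow> sum f A \<in> P_ge \<mu> \<gamma>"
  by (induct A rule: infinite_finite_induct) (auto intro: ge_0 ge_add)

lemma gt_sum: "(\<And>i. i \<in> A \<Longrightarrow> f i \<in> P_gt \<mu> \<gamma>) \<Longrightarrow> sum f A \<in> P_gt \<mu> \<gamma>"
  by (induct A rule: infinite_finite_induct) (auto intro: gt_0 gt_add)

lemma ge_mult: "f \<in> P_ge \<mu> \<beta> \<Longrightarrow> g \<in> P_ge \<mu> \<gamma> \<Longrightarrow> f * g \<in> P_ge \<mu> (\<beta> + \<gamma>)"
  by (simp add: P_ge_def valuation_mult[OF val] extended_add_ge_ge)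

lemma gt_mult: "f \<in> P_gt \<mu> \<beta> \<Longrightarrow> g \<in> P_ge \<mu> \<gamma> \<Longrightarrow> f * g \<in> P_gt \<mu> (\<beta> + \<gamma>)"
  by (simp add: P_ge_def P_gt_def valuation_mult[OF val] extended_add_gt_ge)

lemma gt_mult2: "f \<in> P_ge \<mu> \<beta> \<Longrightarrow> g \<in> P_gt \<mu> \<gamma> \<Longrightarrow> f * g \<in> P_gt \<mu> (\<beta> + \<gamma>)"
  using gt_mult[of g \<gamma> f \<beta>] by (simp add: mult.commute add.commute)

lemma outside_index: "\<gamma> \<notin> value_index \<mu> \<Longrightarrow> f \<in> P_ge \<mu> \<gamma> \<Longrightarrow> f \<in> P_gt \<mu> \<gamma>"
  by (force simp: value_index_def P_ge_def P_gt_def supp_def order.order_iff_strict)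

lemma coset_eq_iff: "coset \<gamma> f = coset \<gamma> g \<longleftrightarrow> f - g \<in> P_gt \<mu> \<gamma>"
proof
  assume "coset \<gamma> f = coset \<gamma> g"
  moreover have "f \<in> coset \<gamma> f" by (simp add: mem_coset gt_0)
  ultimately show "f - g \<in> P_gt \<mu> \<gamma>" by (simp add: mem_coset)
next
  assume d: "f - g \<in> P_gt \<mu> \<gamma>"
  have "x - f \<in> P_gt \<mu> \<gamma> \<longleftrightarrow> x - g \<in> P_gt \<mu> \<gamma>" for x
    using gt_add[OF _ d, of "x - f"] gt_diff[OF _ d, of "x - g"] by auto
  then show "coset \<gamma> f = coset \<gamma> g" by (simp add: set_eq_iff mem_coset)
qed

lemma coset_zero: "coset \<gamma> 0 = P_gt \<mu> \<gamma>"
  by (auto simp: mem_coset)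

lemma coset_eq_zero_iff: "coset \<gamma> f = P_gt \<mu> \<gamma> \<longleftrightarrow> f \<in> P_gt \<mu> \<gamma>"
  using coset_eq_iff[of \<gamma> f 0] by (simp add: coset_zero)

lemma group_ge: "comm_group \<lparr>carrier = P_ge \<mu> \<gamma>, monoid.mult = (+), monoid.one = 0\<rparr>"
  by (rule comm_groupI)
    (auto simp: ge_0 ge_add add.assoc add.commute intro: bexI[of _ "- x" for x] ge_uminus)

lemma subgroup_gt:
  "subgroup (P_gt \<mu> \<gamma>) \<lparr>carrier = P_ge \<mu> \<gamma>, monoid.mult = (+), monoid.one = 0\<rparr>"
  (is "subgroup _ ?P")
proof -
  interpret comm_group ?P by (rule group_ge)
  have "inv\<^bsub>?P\<^esub> f = - f" if "f \<in> P_gt \<mu> \<gamma>" for f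
    by (rule inv_equality) (use that in \<open>auto simp: gt_imp_ge ge_uminus\<close>)
  then show ?thesis
    by (intro subgroupI) (auto simp: gt_imp_ge gt_uminus gt_add, use gt_0 in blast)
qed

lemma component_group: "comm_group (graded_component \<mu> \<gamma>)"
  unfolding graded_component_def
  by (rule comm_group.abelian_FactGroup[OF group_ge subgroup_gt])

lemma component_carrier: "carrier (graded_component \<mu> \<gamma>) = coset \<gamma> ` P_ge \<mu> \<gamma>"
  by (auto simp: graded_component_def FactGroup_def RCOSETS_def r_coset_def coset_def add.commute)

lemma component_one: "\<one>\<^bsub>graded_component \<mu> \<gamma>\<^esub> = P_gt \<mu> \<gamma>"
  by (simp add: graded_component_def FactGroup_def)

lemma component_mult:
  "coset \<gamma> f \<otimes>\<^bsub>graded_component \<mu> \<gamma>\<^esub> coset \<gamma> g = coset \<gamma> (f + g)"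
proof -
  have "coset \<gamma> f <#>\<^bsub>\<lparr>carrier = P_ge \<mu> \<gamma>, monoid.mult = (+), monoid.one = 0\<rparr>\<^esub> coset \<gamma> g
      = coset \<gamma> (f + g)" (is "?L = ?R")
  proof (intro equalityI subsetI)
    fix z assume "z \<in> ?L"
    then obtain a b where z: "z = a + b" "a \<in> coset \<gamma> f" "b \<in> coset \<gamma> g"
      by (auto simp: set_mult_def)
    then have "z - (f + g) = (a - f) + (b - g)" by (simp add: algebra_simps)
    then show "z \<in> ?R" using gt_add[of "a - f" \<gamma> "b - g"] z(2,3) by (simp only: mem_coset)
  next
    fix z assume z: "z \<in> ?R"
    have "z = (z - g) + g" "z - g \<in> coset \<gamma> f" "g \<in> coset \<gamma> g"
      using z gt_0 by (simp_all add: mem_coset algebra_simps)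
    then show "z \<in> ?L"
      unfolding set_mult_def by fastforce
  qed
  then show ?thesis by (simp add: graded_component_def FactGroup_def)
qed

lemma component_sum:
  assumes "finite A" "\<And>i. i \<in> A \<Longrightarrow> f i \<in> P_ge \<mu> \<gamma>"
  shows "finprod (graded_component \<mu> \<gamma>) (\<lambda>i. coset \<gamma> (f i)) A = coset \<gamma> (sum f A)"
proof -
  interpret comm_group "graded_component \<mu> \<gamma>" by (rule component_group)
  show ?thesis
    using assms
  proof (induct A)
    case empty
    show ?case by (simp add: component_one coset_zero)
  next
    case (insert i A)
    then have "(\<lambda>i. coset \<gamma> (f i)) \<in> A \<rightarrow> carrier (graded_component \<mu> \<gamma>)"
      "coset \<gamma> (f i) \<in> carrier (graded_component \<mu> \<gamma>)"
      by (auto simp: component_carrier)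
    then show ?case
      using insert by (simp add: component_mult)
  qed
qed

lemma class_mult_coset:
  assumes "f \<in> P_ge \<mu> \<beta>" "g \<in> P_ge \<mu> \<gamma>"
  shows "class_mult \<mu> (\<beta> + \<gamma>) (coset \<beta> f) (coset \<gamma> g) = coset (\<beta> + \<gamma>) (f * g)"
proof -
  have "x * y + h \<in> coset (\<beta> + \<gamma>) (f * g)"
    if "x \<in> coset \<beta> f" "y \<in> coset \<gamma> g" "h \<in> P_gt \<mu> (\<beta> + \<gamma>)" for x y h
  proof -
    have xy: "x - f \<in> P_gt \<mu> \<beta>" "y - g \<in> P_gt \<mu> \<gamma>" using that by (simp_all add: mem_coset)
    then have "y \<in> P_ge \<mu> \<gamma>" using ge_add[OF gt_imp_ge[OF xy(2)] assms(2)] by simp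
    then have "f * (y - g) + (x - f) * y + h \<in> P_gt \<mu> (\<beta> + \<gamma>)"
      using gt_mult2[OF assms(1) xy(2)] gt_mult[OF xy(1)] that(3) gt_add by blast
    then show ?thesis by (simp add: mem_coset algebra_simps)
  qed
  moreover have "z \<in> class_mult \<mu> (\<beta> + \<gamma>) (coset \<beta> f) (coset \<gamma> g)"
    if "z \<in> coset (\<beta> + \<gamma>) (f * g)" for z
  proof -
    have "z = f * g + (z - f * g)" "z - f * g \<in> P_gt \<mu> (\<beta> + \<gamma>)"
      "f \<in> coset \<beta> f" "g \<in> coset \<gamma> g"
      using that gt_0 by (simp_all add: mem_coset)
    then show ?thesis unfolding class_mult_def mem_Collect_eq by metis
  qed
  ultimately show ?thesis
    unfolding class_mult_def by (intro equalityI subsetI) auto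
qed

text \<open>This is the Rees ring of the filtration by \<open>P_ge\<close>, as a subring of the group ring of \<^typ>\<open>'g\<close>. Families may
  be non-zero at indices \<open>\<gamma>\<close> that are not values: there \<open>P_ge\<close> and \<open>P_gt\<close> coincide, so such
  components do not influence the class.\<close>

definition rees :: "('g \<Rightarrow>\<^sub>0 'a) set" where
  "rees = {r. \<forall>\<gamma>. Poly_Mapping.lookup r \<gamma> \<in> P_ge \<mu> \<gamma>}"

definition graded_class :: "('g \<Rightarrow>\<^sub>0 'a) \<Rightarrow> 'g \<Rightarrow> 'a set" where
  "graded_class r = (\<lambda>\<gamma>\<in>value_index \<mu>. coset \<gamma> (Poly_Mapping.lookup r \<gamma>))"

lemma lookup_in_ge: "r \<in> rees \<Longrightarrow> Poly_Mapping.lookup r \<gamma> \<in> P_ge \<mu> \<gamma>"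
  by (simp add: rees_def)

lemma single_in_rees: "f \<in> P_ge \<mu> \<gamma> \<Longrightarrow> Poly_Mapping.single \<gamma> f \<in> rees"
  by (simp add: rees_def lookup_single when_def ge_0)

lemma lookup_times:
  fixes r s :: "'g \<Rightarrow>\<^sub>0 'a"
  shows "Poly_Mapping.lookup (r * s) \<epsilon> =
    (\<Sum>(\<beta>, \<gamma>) \<in> {(\<beta>, \<gamma>) \<in> Poly_Mapping.keys r \<times> Poly_Mapping.keys s. \<beta> + \<gamma> = \<epsilon>}.
      Poly_Mapping.lookup r \<beta> * Poly_Mapping.lookup s \<gamma>)"
proof -
  let ?f = "\<lambda>(\<beta>, \<gamma>). Poly_Mapping.lookup r \<beta> * Poly_Mapping.lookup s \<gamma> when \<epsilon> = \<beta> + \<gamma>"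
  have "Poly_Mapping.lookup (r * s) \<epsilon> = Sum_any ?f"
    by (simp add: times_poly_mapping.rep_eq prod_fun_unfold_prod)
  also have "\<dots> = sum ?f (Poly_Mapping.keys r \<times> Poly_Mapping.keys s)"
    by (rule Sum_any.expand_superset) (auto simp: in_keys_iff when_def split: if_splits)
  also have "\<dots> = (\<Sum>(\<beta>, \<gamma>) \<in> {(\<beta>, \<gamma>) \<in> Poly_Mapping.keys r \<times> Poly_Mapping.keys s. \<beta> + \<gamma> = \<epsilon>}.
      Poly_Mapping.lookup r \<beta> * Poly_Mapping.lookup s \<gamma>)"
    by (rule sum.mono_neutral_cong_right) (auto simp: when_def split: if_splits)
  finally show ?thesis .
qed

lemma carrier_graded_ring:
  "carrier (graded_ring \<mu>) = {x \<in> \<Pi>\<^sub>E \<gamma>\<in>value_index \<mu>. carrier (graded_component \<mu> \<gamma>).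
    finite {\<gamma> \<in> value_index \<mu>. x \<gamma> \<noteq> P_gt \<mu> \<gamma>}}"
  by (simp add: graded_ring_def Let_def carrier_sum_group component_group comm_group.axioms
      component_one)

lemma carrier_graded_ring_eq: "carrier (graded_ring \<mu>) = graded_class ` rees"
proof (intro equalityI subsetI)
  fix x assume x: "x \<in> carrier (graded_ring \<mu>)"
  have "\<exists>f \<in> P_ge \<mu> \<gamma>. x \<gamma> = coset \<gamma> f" if "\<gamma> \<in> value_index \<mu>" for \<gamma>
    using x that by (auto simp: carrier_graded_ring component_carrier)
  then obtain f where f: "\<And>\<gamma>. \<gamma> \<in> value_index \<mu> \<Longrightarrow> f \<gamma> \<in> P_ge \<mu> \<gamma> \<and> x \<gamma> = coset \<gamma> (f \<gamma>)"
    by metis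
  define r where "r = (\<Sum>\<gamma> \<in> {\<gamma> \<in> value_index \<mu>. x \<gamma> \<noteq> P_gt \<mu> \<gamma>}. Poly_Mapping.single \<gamma> (f \<gamma>))"
  have fin: "finite {\<gamma> \<in> value_index \<mu>. x \<gamma> \<noteq> P_gt \<mu> \<gamma>}"
    using x by (simp add: carrier_graded_ring)
  then have r: "Poly_Mapping.lookup r \<gamma> =
      (if \<gamma> \<in> value_index \<mu> \<and> x \<gamma> \<noteq> P_gt \<mu> \<gamma> then f \<gamma> else 0)" for \<gamma>
    by (simp add: r_def lookup_sum lookup_single when_def sum.delta)
  then have "r \<in> rees" using f by (simp add: rees_def ge_0)
  moreover have "x = graded_class r"
  proof (rule extensionalityI)
    show "x \<in> extensional (value_index \<mu>)" using x by (simp add: carrier_graded_ring PiE_def)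
    show "graded_class r \<in> extensional (value_index \<mu>)" by (simp add: graded_class_def)
    fix \<gamma> assume "\<gamma> \<in> value_index \<mu>"
    then show "x \<gamma> = graded_class r \<gamma>"
      using f r[of \<gamma>] by (simp add: graded_class_def coset_zero)
  qed
  ultimately show "x \<in> graded_class ` rees" by blast
next
  fix x assume "x \<in> graded_class ` rees"
  then obtain r where r: "r \<in> rees" "x = graded_class r" by blast
  have "{\<gamma> \<in> value_index \<mu>. x \<gamma> \<noteq> P_gt \<mu> \<gamma>} \<subseteq> Poly_Mapping.keys r"
    by (auto simp: r graded_class_def in_keys_iff coset_zero)
  then have "finite {\<gamma> \<in> value_index \<mu>. x \<gamma> \<noteq> P_gt \<mu> \<gamma>}"
    by (rule finite_subset) simp
  then show "x \<in> carrier (graded_ring \<mu>)"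
    using r lookup_in_ge by (auto simp: carrier_graded_ring graded_class_def component_carrier)
qed

lemma graded_class_add:
  "graded_class (r + s) = graded_class r \<oplus>\<^bsub>graded_ring \<mu>\<^esub> graded_class s"
  by (rule ext) (simp add: graded_ring_def Let_def graded_class_def component_mult lookup_add)

lemma graded_class_zero: "graded_class 0 = \<zero>\<^bsub>graded_ring \<mu>\<^esub>"
  by (rule ext) (simp add: graded_ring_def Let_def graded_class_def component_one coset_zero)

lemma initial_form_eq: "\<mu> f = Fin \<gamma> \<Longrightarrow> initial_form \<mu> f = graded_class (Poly_Mapping.single \<gamma> f)"
  by (rule ext) (auto simp: initial_form_def graded_class_def lookup_single when_def coset_zero
      coset_def[symmetric])

lemma initial_form_infinite: "\<mu> f = \<infinity> \<Longrightarrow> initial_form \<mu> f = \<zero>\<^bsub>graded_ring \<mu>\<^esub>"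
  unfolding graded_class_zero[symmetric]
  by (rule ext) (auto simp: initial_form_def graded_class_def coset_zero)

lemma graded_class_one: "graded_class 1 = \<one>\<^bsub>graded_ring \<mu>\<^esub>"
proof -
  have "\<mu> 1 = Fin 0" using valuation_1[OF val] by (simp add: zero_extended_def)
  then show ?thesis
    using initial_form_eq[of 1 0] by (simp add: graded_ring_def Let_def)
qed

lemma graded_class_eq_iff:
  assumes "r \<in> rees" "s \<in> rees"
  shows "graded_class r = graded_class s \<longleftrightarrow>
    (\<forall>\<gamma>. Poly_Mapping.lookup r \<gamma> - Poly_Mapping.lookup s \<gamma> \<in> P_gt \<mu> \<gamma>)"
proof -
  have "graded_class r = graded_class s \<longleftrightarrow>
    (\<forall>\<gamma> \<in> value_index \<mu>. Poly_Mapping.lookup r \<gamma> - Poly_Mapping.lookup s \<gamma> \<in> P_gt \<mu> \<gamma>)"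
    unfolding graded_class_def coset_eq_iff[symmetric] by (auto simp: restrict_def fun_eq_iff)
  then show ?thesis
    using assms outside_index ge_diff lookup_in_ge by blast
qed

text \<open>The product in the graded ring sums over pairs of non-zero components, the product of the families
  over pairs in the supports. The additional pairs contribute elements of \<open>P_gt\<close> only.\<close>

lemma graded_class_mult:
  assumes r: "r \<in> rees" and s: "s \<in> rees"
  shows "graded_class (r * s) = graded_class r \<otimes>\<^bsub>graded_ring \<mu>\<^esub> graded_class s"
proof (rule ext)
  fix \<epsilon>
  let ?f = "\<lambda>(\<beta>, \<gamma>). Poly_Mapping.lookup r \<beta> * Poly_Mapping.lookup s \<gamma>"
  show "graded_class (r * s) \<epsilon> = (graded_class r \<otimes>\<^bsub>graded_ring \<mu>\<^esub> graded_class s) \<epsilon>"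
  proof (cases "\<epsilon> \<in> value_index \<mu>")
    case False
    then show ?thesis by (simp add: graded_class_def graded_ring_def Let_def)
  next
    case True
    define S where "S = {(\<beta>, \<gamma>). \<beta> \<in> value_index \<mu> \<and> \<gamma> \<in> value_index \<mu> \<and> \<beta> + \<gamma> = \<epsilon> \<and>
                     graded_class r \<beta> \<noteq> P_gt \<mu> \<beta> \<and> graded_class s \<gamma> \<noteq> P_gt \<mu> \<gamma>}"
    define T where "T = {(\<beta>, \<gamma>) \<in> Poly_Mapping.keys r \<times> Poly_Mapping.keys s. \<beta> + \<gamma> = \<epsilon>}"
    have S: "(\<beta>, \<gamma>) \<in> S \<longleftrightarrow> \<beta> \<in> value_index \<mu> \<and> \<gamma> \<in> value_index \<mu> \<and> \<beta> + \<gamma> = \<epsilon> \<and>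
      Poly_Mapping.lookup r \<beta> \<notin> P_gt \<mu> \<beta> \<and> Poly_Mapping.lookup s \<gamma> \<notin> P_gt \<mu> \<gamma>" for \<beta> \<gamma>
      unfolding S_def mem_Collect_eq prod.case graded_class_def
      by (auto simp: coset_eq_zero_iff)
    have "finite (Poly_Mapping.keys r \<times> Poly_Mapping.keys s)" by simp
    then have "finite T" by (rule rev_finite_subset) (auto simp: T_def)
    moreover have "S \<subseteq> T"
      using gt_0 by (auto simp: S T_def in_keys_iff)
    ultimately have finS: "finite S" by (rule rev_finite_subset)
    have f: "?f p \<in> P_ge \<mu> \<epsilon>" if "p \<in> T" for p
      using that ge_mult lookup_in_ge[OF r] lookup_in_ge[OF s] by (auto simp: T_def)
    have rest: "?f p \<in> P_gt \<mu> \<epsilon>" if p_in: "p \<in> T - S" for p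
    proof -
      obtain \<beta> \<gamma> where p: "p = (\<beta>, \<gamma>)" "\<beta> + \<gamma> = \<epsilon>" "(\<beta>, \<gamma>) \<notin> S"
        using p_in by (auto simp: T_def)
      then have "Poly_Mapping.lookup r \<beta> \<in> P_gt \<mu> \<beta> \<or> Poly_Mapping.lookup s \<gamma> \<in> P_gt \<mu> \<gamma>"
        using S outside_index lookup_in_ge[OF r] lookup_in_ge[OF s] by blast
      then show ?thesis
        using p gt_mult gt_mult2 lookup_in_ge[OF r] lookup_in_ge[OF s] by auto
    qed
    have "(graded_class r \<otimes>\<^bsub>graded_ring \<mu>\<^esub> graded_class s) \<epsilon> =
      finprod (graded_component \<mu> \<epsilon>) (\<lambda>(\<beta>, \<gamma>). class_mult \<mu> \<epsilon> (graded_class r \<beta>) (graded_class s \<gamma>)) S"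
      using True by (simp add: graded_ring_def Let_def S_def)
    also have "\<dots> = finprod (graded_component \<mu> \<epsilon>) (\<lambda>p. coset \<epsilon> (?f p)) S"
    proof (rule comm_monoid.finprod_cong')
      show "comm_monoid (graded_component \<mu> \<epsilon>)" using component_group by (rule comm_group.axioms)
      show "(\<lambda>p. coset \<epsilon> (?f p)) \<in> S \<rightarrow> carrier (graded_component \<mu> \<epsilon>)"
        using f \<open>S \<subseteq> T\<close> unfolding component_carrier by blast
      fix p assume "p \<in> S"
      then obtain \<beta> \<gamma> where p: "p = (\<beta>, \<gamma>)" "\<beta> \<in> value_index \<mu>" "\<gamma> \<in> value_index \<mu>" "\<beta> + \<gamma> = \<epsilon>"
        using S by (cases p) auto
      show "(case p of (\<beta>, \<gamma>) \<Rightarrow> class_mult \<mu> \<epsilon> (graded_class r \<beta>) (graded_class s \<gamma>)) = coset \<epsilon> (?f p)"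
        using class_mult_coset[OF lookup_in_ge[OF r] lookup_in_ge[OF s], of \<beta> \<gamma>] p
        by (simp add: graded_class_def)
    qed simp
    also have "\<dots> = coset \<epsilon> (sum ?f S)"
      by (rule component_sum[OF finS]) (use f \<open>S \<subseteq> T\<close> in blast)
    also have "\<dots> = coset \<epsilon> (sum ?f T)"
    proof -
      have "sum ?f T - sum ?f S = sum ?f (T - S)"
        using sum_diff[OF \<open>finite T\<close> \<open>S \<subseteq> T\<close>, of ?f] by simp
      then show ?thesis
        using gt_sum[of "T - S" ?f, OF rest] coset_eq_iff[of \<epsilon> "sum ?f T" "sum ?f S"] by metis
    qed
    also have "\<dots> = graded_class (r * s) \<epsilon>"
      using True by (simp add: graded_class_def lookup_times T_def)
    finally show ?thesis by simp
  qed
qed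

lemma graded_presentation: "ring_presentation rees graded_class (graded_ring \<mu>)"
proof
  have "\<mu> 1 = Fin 0" using valuation_1[OF val] by (simp add: zero_extended_def)
  then have "(1::'a) \<in> P_ge \<mu> 0" by (simp add: P_ge_def)
  then show "1 \<in> rees" using single_in_rees[of 1 0] by simp
  fix r s assume r: "r \<in> rees" and s: "s \<in> rees"
  then show "r - s \<in> rees" by (simp add: rees_def lookup_minus ge_diff)
  show "r * s \<in> rees"
    unfolding rees_def mem_Collect_eq lookup_times
    using ge_mult lookup_in_ge[OF r] lookup_in_ge[OF s] by (auto intro!: ge_sum)
qed (simp_all add: carrier_graded_ring_eq graded_class_add graded_class_mult graded_class_one
    graded_class_zero)

lemma graded_class_zero_iff:
  assumes "r \<in> rees"
  shows "graded_class r = \<zero>\<^bsub>graded_ring \<mu>\<^esub> \<longleftrightarrow> (\<forall>\<gamma>. Poly_Mapping.lookup r \<gamma> \<in> P_gt \<mu> \<gamma>)"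
  using graded_class_eq_iff[OF assms, of 0] ring_presentation.zero_in[OF graded_presentation]
  by (simp add: graded_class_zero)

lemma single_class_zero:
  assumes "f \<in> P_gt \<mu> \<gamma>"
  shows "graded_class (Poly_Mapping.single \<gamma> f) = \<zero>\<^bsub>graded_ring \<mu>\<^esub>"
  using graded_class_zero_iff[OF single_in_rees[OF gt_imp_ge[OF assms]]] assms gt_0
  by (simp add: lookup_single when_def)

end


section \<open>Maps between graded rings\<close>

lemma sum_singles: "(\<Sum>\<gamma> \<in> Poly_Mapping.keys r. Poly_Mapping.single \<gamma> (Poly_Mapping.lookup r \<gamma>)) = r"
  by (rule poly_mapping_eqI) (simp add: lookup_sum lookup_single when_def in_keys_iff)

locale coarser_valuation = valued_ring \<mu> + finer: valued_ring \<mu>'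
  for \<mu> \<mu>' :: "'a::comm_ring_1 \<Rightarrow> 'g::linordered_ab_group_add extended" +
  assumes le: "\<mu> \<le> \<mu>'"
begin

lemma ge_mono: "f \<in> P_ge \<mu> \<gamma> \<Longrightarrow> f \<in> P_ge \<mu>' \<gamma>"
  using le by (auto simp: P_ge_def le_fun_def intro: order_trans)

lemma gt_mono: "f \<in> P_gt \<mu> \<gamma> \<Longrightarrow> f \<in> P_gt \<mu>' \<gamma>"
  using le by (auto simp: P_gt_def le_fun_def intro: less_le_trans)

lemma rees_mono: "rees \<subseteq> finer.rees"
  using ge_mono by (auto simp: rees_def finer.rees_def)

text \<open>A family with a single entry \<open>f\<close> at \<open>\<gamma>\<close> represents the initial form of \<open>f\<close> or zero, so the
  prescribed values decide its image.\<close>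

lemma initial_form_image:
  assumes \<phi>: "\<And>f. (\<mu> f = \<mu>' f \<longrightarrow> \<phi> (initial_form \<mu> f) = initial_form \<mu>' f) \<and>
      (\<mu> f < \<mu>' f \<longrightarrow> \<phi> (initial_form \<mu> f) = \<zero>\<^bsub>graded_ring \<mu>'\<^esub>)"
    and f: "f \<in> P_ge \<mu> \<gamma>"
  shows "\<phi> (graded_class (Poly_Mapping.single \<gamma> f)) = finer.graded_class (Poly_Mapping.single \<gamma> f)"
proof -
  have zero: "finer.graded_class (Poly_Mapping.single \<gamma> f) = \<zero>\<^bsub>graded_ring \<mu>'\<^esub>" if "Fin \<gamma> < \<mu>' f"
    using that by (intro finer.single_class_zero) (simp add: P_gt_def)
  show ?thesis
  proof (cases "\<mu> f = Fin \<gamma>")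
    case True
    show ?thesis
    proof (cases "\<mu>' f = Fin \<gamma>")
      case True
      with \<open>\<mu> f = Fin \<gamma>\<close> \<phi>[of f] show ?thesis
        by (simp add: initial_form_eq finer.initial_form_eq)
    next
      case False
      then have "\<mu> f < \<mu>' f" using le \<open>\<mu> f = Fin \<gamma>\<close> by (metis le_funD order.not_eq_order_implies_strict)
      then show ?thesis
        using \<phi>[of f] zero initial_form_eq[OF \<open>\<mu> f = Fin \<gamma>\<close>] \<open>\<mu> f = Fin \<gamma>\<close> by simp
    qed
  next
    case False
    then have gt: "f \<in> P_gt \<mu> \<gamma>" using f by (simp add: P_gt_def P_ge_def order.strict_iff_order)
    then have "graded_class (Poly_Mapping.single \<gamma> f) = initial_form \<mu> 0"
      by (simp add: single_class_zero initial_form_infinite[OF valuation_0[OF val]])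
    moreover have "\<phi> (initial_form \<mu> 0) = \<zero>\<^bsub>graded_ring \<mu>'\<^esub>"
      using \<phi>[of 0] by (simp add: valuation_0[OF val] valuation_0[OF finer.val] finer.initial_form_infinite)
    ultimately show ?thesis
      using zero gt_mono[OF gt] by (simp add: P_gt_def)
  qed
qed

text \<open>The prescribed values on initial forms determine the map, because every element is a sum of
  initial forms; and mapping the class of a family of representatives to its class for the finer
  valuation does realise these values.\<close>

lemma graded_map_class:
  assumes "r \<in> rees"
  shows "graded_map \<mu> \<mu>' (graded_class r) = finer.graded_class r"
proof -
  interpret A: ring_presentation rees graded_class "graded_ring \<mu>" by (rule graded_presentation)
  interpret B: ring_presentation finer.rees finer.graded_class "graded_ring \<mu>'"
    by (rule finer.graded_presentation)
  let ?P = "\<lambda>\<phi>. \<phi> \<in> extensional (carrier (graded_ring \<mu>)) \<and>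
     \<phi> \<in> hom (add_monoid (graded_ring \<mu>)) (add_monoid (graded_ring \<mu>')) \<and>
     (\<forall>f. (\<mu> f = \<mu>' f \<longrightarrow> \<phi> (initial_form \<mu> f) = initial_form \<mu>' f) \<and>
          (\<mu> f < \<mu>' f \<longrightarrow> \<phi> (initial_form \<mu> f) = \<zero>\<^bsub>graded_ring \<mu>'\<^esub>))"
  have determined: "\<phi> (graded_class r) = finer.graded_class r" if \<phi>: "?P \<phi>" and r: "r \<in> rees" for \<phi> r
  proof -
    let ?s = "\<lambda>\<gamma>. Poly_Mapping.single \<gamma> (Poly_Mapping.lookup r \<gamma>)"
    have s: "?s \<gamma> \<in> rees" for \<gamma> using single_in_rees lookup_in_ge[OF r] by blast
    have "\<phi> (graded_class (sum ?s K)) = finer.graded_class (sum ?s K)" if "finite K" for K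
      using that
    proof (induct K)
      case empty
      have "graded_class 0 = initial_form \<mu> 0"
        using initial_form_infinite[OF valuation_0[OF val]] by (simp add: graded_class_zero)
      moreover have "initial_form \<mu>' 0 = finer.graded_class 0"
        using finer.initial_form_infinite[OF valuation_0[OF finer.val]]
        by (simp add: finer.graded_class_zero)
      ultimately show ?case
        using \<phi> by (simp add: valuation_0[OF val] valuation_0[OF finer.val])
    next
      case (insert \<gamma> K)
      have "\<phi> (graded_class (?s \<gamma>)) = finer.graded_class (?s \<gamma>)"
        by (rule initial_form_image) (use \<phi> lookup_in_ge[OF r] in auto)
      moreover have "\<phi> (graded_class (?s \<gamma>) \<oplus>\<^bsub>graded_ring \<mu>\<^esub> graded_class (sum ?s K)) =
          \<phi> (graded_class (?s \<gamma>)) \<oplus>\<^bsub>graded_ring \<mu>'\<^esub> \<phi> (graded_class (sum ?s K))"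
        using conjunct1[OF conjunct2[OF \<phi>]] A.closed[OF s] A.closed[OF A.sum_in[of K ?s, OF s]]
        by (auto simp: hom_def)
      ultimately show ?case
        using insert by (simp add: graded_class_add finer.graded_class_add)
    qed
    from this[OF finite_keys[of r]] show ?thesis by (simp add: sum_singles)
  qed
  have "graded_class r = \<zero>\<^bsub>graded_ring \<mu>\<^esub> \<Longrightarrow> finer.graded_class r = \<zero>\<^bsub>graded_ring \<mu>'\<^esub>"
    if "r \<in> rees" for r
    using that rees_mono gt_mono graded_class_zero_iff finer.graded_class_zero_iff by blast
  then obtain h where h: "h \<in> ring_hom (graded_ring \<mu>) (graded_ring \<mu>')"
    "\<And>r. r \<in> rees \<Longrightarrow> h (graded_class r) = finer.graded_class r"
    using A.induced_hom[OF finer.graded_presentation rees_mono] by blast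
  let ?h = "restrict h (carrier (graded_ring \<mu>))"
  have h_class: "?h (graded_class r) = finer.graded_class r" if "r \<in> rees" for r
    using that h(2) A.closed by simp
  have "?h \<in> hom (add_monoid (graded_ring \<mu>)) (add_monoid (graded_ring \<mu>'))"
    using h(1) A.is_cring by (auto simp: hom_def ring_hom_def cring_def ring_def
        abelian_group.axioms abelian_monoid.a_closed)
  moreover have "?h (initial_form \<mu> f) = (if \<mu> f = \<mu>' f then initial_form \<mu>' f else \<zero>\<^bsub>graded_ring \<mu>'\<^esub>)" for f
  proof (cases "\<mu> f")
    case (Fin \<gamma>)
    then have f: "Poly_Mapping.single \<gamma> f \<in> rees" by (simp add: single_in_rees P_ge_def)
    have "?h (initial_form \<mu> f) = finer.graded_class (Poly_Mapping.single \<gamma> f)"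
      using h_class[OF f] Fin by (simp add: initial_form_eq)
    moreover have "finer.graded_class (Poly_Mapping.single \<gamma> f) = \<zero>\<^bsub>graded_ring \<mu>'\<^esub>" if "\<mu> f \<noteq> \<mu>' f"
    proof -
      have "Fin \<gamma> < \<mu>' f" using that le Fin by (metis le_funD order.not_eq_order_implies_strict)
      then show ?thesis by (intro finer.single_class_zero) (simp add: P_gt_def)
    qed
    ultimately show ?thesis using Fin finer.initial_form_eq[of f \<gamma>] by auto
  next
    case Pinf
    then have "\<mu>' f = \<infinity>" using le by (metis Pinf_le le_funD)
    then show ?thesis
      using Pinf h_class[OF A.zero_in]
      by (simp add: initial_form_infinite finer.initial_form_infinite graded_class_zero
          finer.graded_class_zero)
  next
    case Minf
    then show ?thesis using valuation_not_Minf[OF val] by blast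
  qed
  ultimately have h_P: "?P ?h" by auto
  have "graded_map \<mu> \<mu>' = ?h"
    unfolding graded_map_def
  proof (rule the_equality)
    show "?P ?h" by (rule h_P)
    fix \<phi> assume \<phi>: "?P \<phi>"
    show "\<phi> = ?h"
    proof (rule extensionalityI)
      show "\<phi> \<in> extensional (carrier (graded_ring \<mu>))" using \<phi> by blast
      show "?h \<in> extensional (carrier (graded_ring \<mu>))" by simp
      fix x assume "x \<in> carrier (graded_ring \<mu>)"
      then obtain r where "r \<in> rees" "x = graded_class r" by (auto simp: A.carrier_eq)
      then show "\<phi> x = ?h x" using determined[OF \<phi>] h_class by simp
    qed
  qed
  then show ?thesis using h_class[OF assms] by simp
qed

end

section \<open>Expansions and truncations\<close>

text \<open>Uniqueness of expansions: the lowest digit is divisible by \<open>q\<close>, hence zero, and \<open>q\<close> can be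
  cancelled.\<close>

lemma expansion_zero:
  fixes q :: "'k::field poly"
  assumes "\<And>i. Polynomial.degree (Polynomial.coeff F i) < Polynomial.degree q" and "poly F q = 0"
  shows "F = 0"
  using assms
proof (induct F)
  case (pCons a F)
  have "a = - q * poly F q" using pCons.prems(2) by (simp add: add_eq_0_iff2)
  then have "q dvd a" by simp
  moreover have "Polynomial.degree a < Polynomial.degree q" using pCons.prems(1)[of 0] by simp
  ultimately have "a = 0" using dvd_imp_degree_le[of q a] by linarith
  moreover have "q \<noteq> 0" using pCons.prems(1)[of 0] by auto
  ultimately have "poly F q = 0" using pCons.prems(2) by simp
  then have "F = 0" using pCons.hyps(2) pCons.prems(1)[of "Suc i" for i] by simp
  with \<open>a = 0\<close> show ?case by simp
qed simp

lemma degree_mod_less_pos: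
  fixes q :: "'k::field poly"
  assumes "0 < Polynomial.degree q"
  shows "Polynomial.degree (f mod q) < Polynomial.degree q"
proof (cases "f mod q = 0")
  case False
  have "q \<noteq> 0" using assms by auto
  then show ?thesis using degree_mod_less'[of q f] False by blast
qed (simp add: assms)

lemma degree_div_less:
  fixes q :: "'k::field poly"
  assumes "0 < Polynomial.degree q" "0 < m" "Polynomial.degree f < m + Polynomial.degree q"
  shows "Polynomial.degree (f div q) < m"
proof (cases "f div q = 0")
  case False
  have "q \<noteq> 0" using assms(1) by auto
  have "Polynomial.degree (f mod q) < Polynomial.degree q"
    using assms(1) by (rule degree_mod_less_pos)
  moreover have "Polynomial.degree (f div q) + Polynomial.degree q = Polynomial.degree (f - f mod q)"
    using False \<open>q \<noteq> 0\<close> by (simp add: minus_mod_eq_div_mult degree_mult_eq)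
  moreover have "Polynomial.degree (f - f mod q) \<le> max (Polynomial.degree f) (Polynomial.degree (f mod q))"
    by (rule degree_diff_le_max)
  ultimately show ?thesis using assms(3) by simp
qed (simp add: assms)

lemma expansion_exists:
  fixes q :: "'k::field poly"
  assumes "0 < Polynomial.degree q"
  shows "\<exists>F. poly F q = f \<and> (\<forall>i. Polynomial.degree (Polynomial.coeff F i) < Polynomial.degree q)"
proof (induct "Polynomial.degree f" arbitrary: f rule: less_induct)
  case less
  show ?case
  proof (cases "Polynomial.degree f < Polynomial.degree q")
    case True
    then show ?thesis
      using assms by (intro exI[of _ "[:f:]"]) (auto simp: coeff_pCons split: nat.splits)
  next
    case False
    then have "Polynomial.degree (f div q) < Polynomial.degree f"
      using assms by (intro degree_div_less) simp_all
    then obtain F where F: "poly F q = f div q"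
      "\<forall>i. Polynomial.degree (Polynomial.coeff F i) < Polynomial.degree q"
      using less by blast
    have "Polynomial.degree (f mod q) < Polynomial.degree q"
      using assms by (rule degree_mod_less_pos)
    moreover have "f mod q + q * (f div q) = f" by (metis add.commute mult_div_mod_eq)
    ultimately show ?thesis
      using F by (intro exI[of _ "pCons (f mod q) F"]) (auto simp: coeff_pCons split: nat.splits)
  qed
qed

lemma q_expansion_unique:
  fixes q :: "'k::field poly"
  assumes "poly F q = f" "\<And>i. Polynomial.degree (Polynomial.coeff F i) < Polynomial.degree q"
  shows "q_expansion q f = F"
  unfolding q_expansion_def
proof (rule the_equality)
  fix G assume G: "poly G q = f \<and> (\<forall>i. Polynomial.degree (Polynomial.coeff G i) < Polynomial.degree q)"
  have "G - F = 0"
    by (rule expansion_zero[of _ q]) (use G assms in \<open>auto intro: degree_diff_less\<close>)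
  then show "G = F" by simp
next
  show "poly F q = f \<and> (\<forall>i. Polynomial.degree (Polynomial.coeff F i) < Polynomial.degree q)"
    using assms by blast
qed

context
  fixes q :: "'k::field poly"
  assumes deg_q: "0 < Polynomial.degree q"
begin

lemma q_expansion_poly: "poly (q_expansion q f) q = f"
  and q_expansion_degree:
    "Polynomial.degree (Polynomial.coeff (q_expansion q f) i) < Polynomial.degree q"
proof -
  obtain F where F: "poly F q = f"
    "\<And>i. Polynomial.degree (Polynomial.coeff F i) < Polynomial.degree q"
    using expansion_exists[OF deg_q, of f] by auto
  have "q_expansion q f = F" by (rule q_expansion_unique[OF F])
  then show "poly (q_expansion q f) q = f"
    "Polynomial.degree (Polynomial.coeff (q_expansion q f) i) < Polynomial.degree q"
    using F by simp_all
qed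

lemma q_expansion_low: "Polynomial.degree f < Polynomial.degree q \<Longrightarrow> q_expansion q f = [:f:]"
proof (rule q_expansion_unique)
  fix i assume "Polynomial.degree f < Polynomial.degree q"
  then show "Polynomial.degree (Polynomial.coeff [:f:] i) < Polynomial.degree q"
    using deg_q by (cases i) simp_all
qed simp

lemma q_expansion_add: "q_expansion q (f + g) = q_expansion q f + q_expansion q g"
  by (rule q_expansion_unique) (simp_all add: q_expansion_poly q_expansion_degree degree_add_less)

lemma q_expansion_diff: "q_expansion q (f - g) = q_expansion q f - q_expansion q g"
  by (rule q_expansion_unique) (simp_all add: q_expansion_poly q_expansion_degree degree_diff_less)

lemma q_expansion_mult_q: "q_expansion q (f * q) = pCons 0 (q_expansion q f)"
proof (rule q_expansion_unique)
  show "Polynomial.degree (Polynomial.coeff (pCons 0 (q_expansion q f)) i) < Polynomial.degree q" for i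
    using deg_q q_expansion_degree by (cases i) simp_all
qed (simp add: q_expansion_poly mult.commute)

lemma q_expansion_coeff_0: "Polynomial.coeff (q_expansion q f) 0 = f mod q"
proof -
  have "f = poly (q_expansion q f) q" by (simp add: q_expansion_poly)
  also have "\<dots> mod q = Polynomial.coeff (q_expansion q f) 0 mod q"
    by (cases "q_expansion q f") (simp add: mod_mult_self2 mult.commute)
  finally show ?thesis by (simp add: mod_poly_less q_expansion_degree)
qed

lemma q_expansion_sum:
  "f = (\<Sum>i\<le>Polynomial.degree (q_expansion q f). Polynomial.coeff (q_expansion q f) i * q ^ i)"
  using q_expansion_poly[of f] by (simp add: poly_altdef)

lemma q_expansion_split:
  "f = poly (poly_cutoff n (q_expansion q f)) q + poly (poly_shift n (q_expansion q f)) q * q ^ n"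
proof -
  have "F = poly_cutoff n F + poly_shift n F * Polynomial.monom 1 n" for F :: "'k poly poly"
    by (rule poly_eqI)
      (auto simp: coeff_poly_cutoff coeff_poly_shift coeff_monom_mult mult.commute[of _ "Polynomial.monom 1 n"])
  from arg_cong[OF this, of "\<lambda>F. poly F q" "q_expansion q f"] show ?thesis
    by (simp add: q_expansion_poly poly_monom)
qed

lemma q_expansion_cutoff:
  "q_expansion q (poly (poly_cutoff n (q_expansion q f)) q) = poly_cutoff n (q_expansion q f)"
  by (rule q_expansion_unique) (auto simp: coeff_poly_cutoff q_expansion_degree deg_q)

lemma q_expansion_shift:
  "q_expansion q (poly (poly_shift n (q_expansion q f)) q) = poly_shift n (q_expansion q f)"
  by (rule q_expansion_unique) (auto simp: coeff_poly_shift q_expansion_degree)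

end

text \<open>What is used of key polynomials. Key polynomials in the sense of \<open>\<delta>\<close> and limit key
  polynomials have this property for different reasons. Products of polynomials of low degree may
  be reduced modulo \<open>q\<close> without changing their initial forms.\<close>

locale abstract_key_poly =
  fixes \<nu> :: "'k::field poly \<Rightarrow> 'g::linordered_ab_group_add extended" and q :: "'k poly"
  assumes val: "valuation \<nu>"
    and deg_pos: "0 < Polynomial.degree q"
    and finite_below: "\<And>u. u \<noteq> 0 \<Longrightarrow> Polynomial.degree u < Polynomial.degree q \<Longrightarrow> \<nu> u \<noteq> \<infinity>"
    and quotient_gt: "\<And>u v. u \<noteq> 0 \<Longrightarrow> v \<noteq> 0 \<Longrightarrow> Polynomial.degree u < Polynomial.degree q \<Longrightarrow>
      Polynomial.degree v < Polynomial.degree q \<Longrightarrow> \<nu> (u * v) < \<nu> ((u * v) div q * q)"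
begin

abbreviation "tr \<equiv> truncation \<nu> q"
abbreviation "digit f i \<equiv> Polynomial.coeff (q_expansion q f) i"

lemma ge_tr_iff: "x \<le> tr f \<longleftrightarrow> (\<forall>i. x \<le> \<nu> (digit f i * q ^ i))"
proof -
  have "x \<le> \<nu> (digit f i * q ^ i)" if "\<not> i \<le> Polynomial.degree (q_expansion q f)" for i
    using that by (simp add: coeff_eq_0 valuation_0[OF val])
  then show ?thesis by (auto simp: truncation_def Let_def)
qed

lemma tr_le_digit: "tr f \<le> \<nu> (digit f i * q ^ i)"
  using ge_tr_iff by blast

lemma tr_attained: "\<exists>i. tr f = \<nu> (digit f i * q ^ i)"
proof -
  have "tr f \<in> (\<lambda>i. \<nu> (digit f i * q ^ i)) ` {0..Polynomial.degree (q_expansion q f)}"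
    unfolding truncation_def Let_def by (rule Min_in) auto
  then show ?thesis by blast
qed

lemma gt_tr_iff: "x < tr f \<longleftrightarrow> (\<forall>i. x < \<nu> (digit f i * q ^ i))"
  using tr_attained[of f] tr_le_digit[of f] by (metis less_le_trans)

lemma tr_low: "Polynomial.degree f < Polynomial.degree q \<Longrightarrow> tr f = \<nu> f"
  by (simp add: truncation_def q_expansion_low[OF deg_pos])

lemma tr_le: "tr f \<le> \<nu> f"
  using valuation_sum[OF val, of "{..Polynomial.degree (q_expansion q f)}" "tr f"
      "\<lambda>i. digit f i * q ^ i"] tr_le_digit q_expansion_sum[OF deg_pos, of f] by simp

lemma tr_0: "tr 0 = \<infinity>"
  using tr_low[of 0] deg_pos valuation_0[OF val] by simp

lemma tr_ge_add: "x \<le> tr f \<Longrightarrow> x \<le> tr g \<Longrightarrow> x \<le> tr (f + g)"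
  unfolding ge_tr_iff q_expansion_add[OF deg_pos]
  by (simp add: distrib_right valuation_ge_add[OF val])

lemma tr_sum: "(\<And>i. i \<in> A \<Longrightarrow> x \<le> tr (f i)) \<Longrightarrow> x \<le> tr (sum f A)"
  by (induct A rule: infinite_finite_induct) (auto simp: tr_0 tr_ge_add)

lemma tr_gt_diff: "x < tr f \<Longrightarrow> x < tr g \<Longrightarrow> x < tr (f - g)"
  unfolding gt_tr_iff q_expansion_diff[OF deg_pos]
  by (simp add: left_diff_distrib valuation_gt_diff[OF val])

lemma tr_ge_diff: "x \<le> tr f \<Longrightarrow> x \<le> tr g \<Longrightarrow> x \<le> tr (f - g)"
  unfolding ge_tr_iff q_expansion_diff[OF deg_pos]
  by (simp add: left_diff_distrib valuation_ge_diff[OF val])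

lemma tr_mult_q: "tr (f * q) = tr f + \<nu> q"
proof (rule antisym)
  have digit: "\<nu> (digit (f * q) (Suc i) * q ^ Suc i) = \<nu> (digit f i * q ^ i) + \<nu> q" for i
    by (simp add: q_expansion_mult_q[OF deg_pos] valuation_mult[OF val] ac_simps)
  obtain i where "tr f = \<nu> (digit f i * q ^ i)" using tr_attained by blast
  then show "tr (f * q) \<le> tr f + \<nu> q" using tr_le_digit[of "f * q" "Suc i"] digit[of i] by simp
  have "tr f + \<nu> q \<le> \<nu> (digit (f * q) i * q ^ i)" for i
  proof (cases i)
    case 0
    then show ?thesis by (simp add: q_expansion_mult_q[OF deg_pos] valuation_0[OF val])
  next
    case (Suc j)
    then show ?thesis using digit[of j] tr_le_digit[of f j] by (simp add: add_right_mono)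
  qed
  then show "tr f + \<nu> q \<le> tr (f * q)" by (simp add: ge_tr_iff)
qed

lemma tr_mult_power: "tr (f * q ^ i) = tr f + \<nu> (q ^ i)"
proof (induct i)
  case (Suc i)
  have "tr (f * q ^ Suc i) = tr (f * q ^ i) + \<nu> q"
    using tr_mult_q[of "f * q ^ i"] by (simp add: ac_simps)
  then show ?case using Suc by (simp add: valuation_mult[OF val] ac_simps)
qed (simp add: valuation_1[OF val])

lemma tr_le_mod: "tr f \<le> \<nu> (f mod q)"
  using tr_le_digit[of f 0] by (simp add: q_expansion_coeff_0[OF deg_pos])

lemma mod_degree: "Polynomial.degree (f mod q) < Polynomial.degree q"
  using deg_pos by (rule degree_mod_less_pos)

lemma value_mod_mult:
  assumes "u \<noteq> 0" "v \<noteq> 0" "Polynomial.degree u < Polynomial.degree q"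
    "Polynomial.degree v < Polynomial.degree q"
  shows "\<nu> ((u * v) mod q) = \<nu> u + \<nu> v"
  using valuation_diff_eq[OF val quotient_gt[OF assms]]
  by (simp add: valuation_mult[OF val, of u v] minus_div_mult_eq_mod)

lemma tr_mult_low:
  assumes "Polynomial.degree u < Polynomial.degree q" "Polynomial.degree v < Polynomial.degree q"
  shows "\<nu> u + \<nu> v \<le> tr (u * v)"
proof (cases "u = 0 \<or> v = 0")
  case True
  then show ?thesis using tr_0 by auto
next
  case False
  let ?d = "(u * v) div q" and ?c = "(u * v) mod q"
  have "Polynomial.degree ?d < Polynomial.degree q"
    using assms False deg_pos by (intro degree_div_less) (simp_all add: degree_mult_eq)
  then have "tr (?d * q) = \<nu> (?d * q)"
    by (simp add: tr_mult_q tr_low valuation_mult[OF val])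
  moreover have "tr ?c = \<nu> u + \<nu> v"
    using value_mod_mult[of u v] assms False by (simp add: tr_low mod_degree)
  moreover have "\<nu> u + \<nu> v < \<nu> (?d * q)"
    using quotient_gt[of u v] assms False by (simp add: valuation_mult[OF val, of u v])
  ultimately have "\<nu> u + \<nu> v \<le> tr (?d * q + ?c)" by (intro tr_ge_add) simp_all
  then show ?thesis by simp
qed

lemma tr_superadditive: "tr f + tr g \<le> tr (f * g)"
proof -
  let ?t = "\<lambda>i j. (digit f i * digit g j) * q ^ (i + j)"
  have "f * g = (\<Sum>i\<le>Polynomial.degree (q_expansion q f). \<Sum>j\<le>Polynomial.degree (q_expansion q g). ?t i j)"
    by (subst q_expansion_sum[OF deg_pos, of f], subst q_expansion_sum[OF deg_pos, of g])
      (simp add: sum_product power_add ac_simps)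
  moreover have "tr f + tr g \<le> tr (?t i j)" for i j
  proof -
    have "tr f + tr g \<le> \<nu> (digit f i * q ^ i) + \<nu> (digit g j * q ^ j)"
      using tr_le_digit by (intro add_mono)
    also have "\<dots> = (\<nu> (digit f i) + \<nu> (digit g j)) + \<nu> (q ^ (i + j))"
      by (simp add: valuation_mult[OF val] power_add ac_simps)
    also have "\<dots> \<le> tr (?t i j)"
      unfolding tr_mult_power
      by (intro add_right_mono tr_mult_low q_expansion_degree deg_pos)
    finally show ?thesis .
  qed
  ultimately show ?thesis by (auto intro!: tr_sum)
qed

text \<open>Superadditivity is digitwise. For the converse, cut both factors at the lowest digits that attain
  the truncated values. The parts below are negligible, and the product of the remaining parts,
  divided by a power of \<open>q\<close>, has as its lowest digit the product of the two cutting digits reduced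
  modulo \<open>q\<close>, whose value is the sum of their values.\<close>

lemma tr_multiplicative: "tr (f * g) = tr f + tr g"
proof (rule antisym)
  show "tr f + tr g \<le> tr (f * g)" by (rule tr_superadditive)
  have not_Minf: "tr h \<noteq> -\<infinity>" for h
    using tr_attained[of h] valuation_not_Minf[OF val] by metis
  show "tr (f * g) \<le> tr f + tr g"
  proof (cases "tr f = \<infinity> \<or> tr g = \<infinity>")
    case True
    then have "tr f + tr g = \<infinity>" using not_Minf[of f] not_Minf[of g] by (cases "tr f"; cases "tr g") auto
    then show ?thesis by simp
  next
    case False
    then obtain a b where a: "tr f = Fin a" and b: "tr g = Fin b"
      using not_Minf by (metis extended.exhaust)
    have split: "\<exists>A w i. h = A + w * q ^ i \<and> Fin c < tr A \<and> w mod q \<noteq> 0 \<and>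
        \<nu> (w mod q) + \<nu> (q ^ i) = Fin c" if hc: "tr h = Fin c" for h c
    proof -
      define i where "i = (LEAST i. \<nu> (digit h i * q ^ i) = Fin c)"
      define A where "A = poly (poly_cutoff i (q_expansion q h)) q"
      define w where "w = poly (poly_shift i (q_expansion q h)) q"
      have i: "\<nu> (digit h i * q ^ i) = Fin c"
      proof -
        obtain j where "\<nu> (digit h j * q ^ j) = Fin c" using tr_attained[of h] hc by auto
        then show ?thesis unfolding i_def by (rule LeastI)
      qed
      have w: "w mod q = digit h i"
        using q_expansion_coeff_0[OF deg_pos, of w]
        by (simp add: w_def q_expansion_shift[OF deg_pos] coeff_poly_shift)
      have "Fin c < \<nu> (digit A j * q ^ j)" for j
      proof (cases "j < i")
        case True
        then have "\<nu> (digit h j * q ^ j) \<noteq> Fin c" unfolding i_def by (rule not_less_Least)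
        then show ?thesis
          using tr_le_digit[of h j] hc True
          by (simp add: A_def q_expansion_cutoff[OF deg_pos] coeff_poly_cutoff order.strict_iff_order)
      next
        case False
        then show ?thesis
          by (simp add: A_def q_expansion_cutoff[OF deg_pos] coeff_poly_cutoff valuation_0[OF val])
      qed
      then have "Fin c < tr A" by (simp add: gt_tr_iff)
      moreover have "h = A + w * q ^ i"
        unfolding A_def w_def by (rule q_expansion_split[OF deg_pos])
      moreover have "w mod q \<noteq> 0"
        using i w valuation_0[OF val] by auto
      ultimately show ?thesis
        using i w by (metis valuation_mult[OF val])
    qed
    obtain A w i where f: "f = A + w * q ^ i" "Fin a < tr A" "w mod q \<noteq> 0"
      "\<nu> (w mod q) + \<nu> (q ^ i) = Fin a"
      using split[OF a] by blast
    obtain B v j where g: "g = B + v * q ^ j" "Fin b < tr B" "v mod q \<noteq> 0"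
      "\<nu> (v mod q) + \<nu> (q ^ j) = Fin b"
      using split[OF b] by blast
    have "tr (w * v) \<le> \<nu> ((w mod q) * (v mod q) mod q)"
      using tr_le_mod[of "w * v"] by (simp add: mod_mult_eq)
    also have "\<dots> = \<nu> (w mod q) + \<nu> (v mod q)"
      by (rule value_mod_mult) (simp_all add: f g mod_degree)
    finally have "tr (w * v * q ^ (i + j)) \<le> (\<nu> (w mod q) + \<nu> (v mod q)) + \<nu> (q ^ (i + j))"
      unfolding tr_mult_power by (rule add_right_mono)
    also have "\<dots> = (\<nu> (w mod q) + \<nu> (q ^ i)) + (\<nu> (v mod q) + \<nu> (q ^ j))"
      by (simp add: power_add valuation_mult[OF val] ac_simps)
    finally have lowest: "tr (w * v * q ^ (i + j)) \<le> Fin (a + b)" by (simp add: f g)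
    have "Fin a \<le> tr (f - A)" using a f(2) by (intro tr_ge_diff) simp_all
    then have "Fin a \<le> tr (w * q ^ i)" using f(1) by simp
    then have "Fin (a + b) < tr (B * (w * q ^ i))"
      using extended_add_gt_ge[OF g(2)] tr_superadditive by (simp add: add.commute[of a]) (meson less_le_trans)
    moreover have "Fin (a + b) < tr (A * g)"
      using extended_add_gt_ge[OF f(2), of b "tr g"] b tr_superadditive by (metis order_refl less_le_trans)
    moreover have "f * g - A * g - B * (w * q ^ i) = w * v * q ^ (i + j)"
      by (simp add: f(1) g(1) algebra_simps power_add)
    ultimately have "\<not> Fin (a + b) < tr (f * g)"
      using lowest tr_gt_diff[of "Fin (a + b)"] by (metis leD)
    then show ?thesis by (simp add: a b)
  qed
qed

lemma valuation_tr: "valuation tr"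
  unfolding valuation_def
proof (intro conjI allI)
  show "tr f \<noteq> -\<infinity>" for f using tr_attained[of f] valuation_not_Minf[OF val] by metis
  show "min (tr f) (tr g) \<le> tr (f + g)" for f g by (rule tr_ge_add) simp_all
  show "tr 1 = 0" using tr_low[of 1] deg_pos valuation_1[OF val] by simp
qed (simp_all add: tr_multiplicative tr_0)

end


section \<open>Key polynomials\<close>

text \<open>Let \<open>a\<close> be closer to the generic point \<open>x\<close> than every root \<open>b\<close> of \<open>f\<close> is. Then each factor
  \<open>x - b = (a - b) + (x - a)\<close> of \<open>f\<close> differs from \<open>a - b\<close> by a term of higher value only, and so \<open>f\<close>
  differs from \<open>f(a)\<close> by terms of higher value only.\<close>

lemma value_minus_constant:
  fixes \<nu> :: "'a::alg_closed_field poly \<Rightarrow> 'g::linordered_ab_group_add extended"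
  assumes val: "valuation \<nu>" and "f \<noteq> 0"
    and fin: "\<And>c. c \<noteq> 0 \<Longrightarrow> \<nu> [:c:] \<noteq> \<infinity>"
    and roots: "\<And>b. poly f b = 0 \<Longrightarrow> \<nu> [:- b, 1:] < \<nu> [:- a, 1:]"
  shows "\<nu> f \<noteq> \<infinity> \<and> \<nu> f < \<nu> (f - [:poly f a:])"
  using \<open>f \<noteq> 0\<close> roots
proof (induct "Polynomial.degree f" arbitrary: f)
  case 0
  then obtain c where "f = [:c:]" by (metis degree_eq_zeroE)
  with 0 fin[of c] show ?case
    by (cases "\<nu> [:c:]") (auto simp: valuation_0[OF val] valuation_not_Minf[OF val])
next
  case (Suc n)
  then obtain b where "poly f b = 0" using alg_closed_imp_poly_has_root[of f] by force
  then obtain g where f: "f = [:- b, 1:] * g" by (auto simp: poly_eq_0_iff_dvd)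
  have "g \<noteq> 0" using Suc.prems(1) f by auto
  have "Suc n = Suc (Polynomial.degree g)"
    using Suc.hyps(2) \<open>g \<noteq> 0\<close> unfolding f by (subst (asm) degree_mult_eq) auto
  then have g: "\<nu> g \<noteq> \<infinity>" "\<nu> g < \<nu> (g - [:poly g a:])"
    using Suc.hyps(1)[of g] \<open>g \<noteq> 0\<close> Suc.prems(2) f by auto
  have b: "\<nu> [:- b, 1:] < \<nu> [:- a, 1:]" by (rule Suc.prems(2)) (simp add: f)
  obtain x where x: "\<nu> [:- b, 1:] = Fin x"
    using b valuation_not_Minf[OF val] by (cases "\<nu> [:- b, 1:]") auto
  obtain y where y: "\<nu> g = Fin y"
    using g valuation_not_Minf[OF val] by (cases "\<nu> g") auto
  have "\<nu> [:poly g a:] = \<nu> g"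
    using valuation_diff_eq[OF val g(2)] by simp
  then have "Fin (x + y) < \<nu> ([:- a, 1:] * [:poly g a:])"
    using extended_add_gt_ge[of x "\<nu> [:- a, 1:]" y "Fin y"] b x y
    by (simp only: valuation_mult[OF val] order_refl)
  moreover have "Fin (x + y) < \<nu> ([:- b, 1:] * (g - [:poly g a:]))"
    using extended_add_gt_ge[of y "\<nu> (g - [:poly g a:])" x "Fin x"] g x y
    by (simp only: valuation_mult[OF val] order_refl add.commute)
  moreover have "f - [:poly f a:] = [:- b, 1:] * (g - [:poly g a:]) + [:- a, 1:] * [:poly g a:]"
    by (simp add: f algebra_simps)
  ultimately have "Fin (x + y) < \<nu> (f - [:poly f a:])"
    using valuation_gt_add[OF val] by metis
  moreover have "\<nu> f = Fin (x + y)" by (simp only: f valuation_mult[OF val] x y plus_extended.simps)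
  ultimately show ?case by simp
qed

lemma map_poly_to_ac_mult: "map_poly to_ac (f * g) = map_poly to_ac f * map_poly to_ac g"
  by (rule poly_eqI) (simp add: coeff_map_poly coeff_mult to_ac_sum)

lemma map_poly_to_ac_diff: "map_poly to_ac (f - g) = map_poly to_ac f - map_poly to_ac g"
  by (rule poly_eqI) (simp add: coeff_map_poly)

lemma map_poly_to_ac_eq_0_iff: "map_poly to_ac f = 0 \<longleftrightarrow> f = 0"
  by (simp add: poly_eq_iff coeff_map_poly)

lemma degree_map_poly_to_ac: "Polynomial.degree (map_poly to_ac f) = Polynomial.degree f"
  by (rule degree_map_poly) simp

text \<open>Let \<open>a\<close> be a root of \<open>Q\<close> at which \<open>\<delta>\<close> is attained. All roots of polynomials of degree below that of \<open>Q\<close>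
  are farther from the generic point than \<open>a\<close>, so \<open>u v\<close> and its remainder \<open>c\<close> modulo \<open>Q\<close> are
  both equal to their values at \<open>a\<close> up to higher terms. These values agree because \<open>Q(a) = 0\<close>;
  hence \<open>u v - c\<close> has a value above that of \<open>u v\<close>.\<close>

lemma key_poly_imp_abstract:
  fixes \<nu>bar :: "'k::field alg_closure poly \<Rightarrow> 'g::linordered_ab_group_add extended"
  assumes val: "valuation \<nu>" and valbar: "valuation \<nu>bar"
    and ext: "\<And>f. \<nu>bar (map_poly to_ac f) = \<nu> f"
    and key: "key_poly \<nu>bar Q" and deg: "0 < Polynomial.degree Q"
  shows "abstract_key_poly \<nu> Q"
proof -
  let ?l = "map_poly to_ac :: 'k poly \<Rightarrow> _"
  have fin: "\<nu>bar [:c:] \<noteq> \<infinity>" if "c \<noteq> 0" for c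
  proof
    assume "\<nu>bar [:c:] = \<infinity>"
    moreover have "[:c:] * [:inverse c:] = 1"
      using that by (simp add: one_pCons)
    then have "\<nu>bar [:c:] + \<nu>bar [:inverse c:] = 0"
      using valuation_mult[OF valbar] valuation_1[OF valbar] by metis
    ultimately show False
      using valuation_not_Minf[OF valbar, of "[:inverse c:]"]
      by (cases "\<nu>bar [:inverse c:]") (auto simp: zero_extended_def)
  qed
  have fin_roots: "finite {\<nu>bar [:- a, 1:] |a. poly (?l f) a = 0}" if "f \<noteq> 0" for f
    using poly_roots_finite[of "?l f"] that by (simp add: map_poly_to_ac_eq_0_iff)
  have "Q \<noteq> 0" using deg by auto
  obtain a0 where "poly (?l Q) a0 = 0"
    using alg_closed_imp_poly_has_root[of "?l Q"] deg by (auto simp: degree_map_poly_to_ac)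
  then have "Max {\<nu>bar [:- a, 1:] |a. poly (?l Q) a = 0} \<in> {\<nu>bar [:- a, 1:] |a. poly (?l Q) a = 0}"
    by (intro Max_in fin_roots[OF \<open>Q \<noteq> 0\<close>]) auto
  then obtain a where a: "poly (?l Q) a = 0" "\<delta> \<nu>bar Q = \<nu>bar [:- a, 1:]"
    using deg by (auto simp: root_level_def)
  \<comment> \<open>the defining property of key polynomials enters here\<close>
  have low_roots: "\<nu>bar [:- b, 1:] < \<nu>bar [:- a, 1:]"
    if "u \<noteq> 0" "Polynomial.degree u < Polynomial.degree Q" "poly (?l u) b = 0" for u b
  proof -
    have "Polynomial.degree u \<noteq> 0"
    proof
      assume "Polynomial.degree u = 0"
      then obtain c where "u = [:c:]" by (metis degree_eq_zeroE)
      with that show False by (simp add: map_poly_pCons)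
    qed
    then have "\<nu>bar [:- b, 1:] \<le> \<delta> \<nu>bar u"
      using that fin_roots[OF that(1)] by (auto simp: root_level_def intro!: Max_ge)
    also have "\<delta> \<nu>bar u < \<delta> \<nu>bar Q"
      using key that by (auto simp: key_poly_def not_le[symmetric])
    finally show ?thesis using a by simp
  qed
  have low: "\<nu> u \<noteq> \<infinity> \<and> \<nu> u < \<nu>bar (?l u - [:poly (?l u) a:])"
    if "u \<noteq> 0" "Polynomial.degree u < Polynomial.degree Q" for u
    unfolding ext[symmetric]
    by (rule value_minus_constant[OF valbar])
      (use that fin low_roots in \<open>auto simp: map_poly_to_ac_eq_0_iff\<close>)
  show ?thesis
  proof
    show "valuation \<nu>" by (rule val)
    show "0 < Polynomial.degree Q" by (rule deg)
    show "\<nu> u \<noteq> \<infinity>" if "u \<noteq> 0" "Polynomial.degree u < Polynomial.degree Q" for u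
      using low that by blast
    fix u v :: "'k poly"
    assume uv: "u \<noteq> 0" "v \<noteq> 0" "Polynomial.degree u < Polynomial.degree Q"
      "Polynomial.degree v < Polynomial.degree Q"
    define c where "c = (u * v) mod Q"
    have c: "Polynomial.degree c < Polynomial.degree Q"
      unfolding c_def using deg by (rule degree_mod_less_pos)
    have quot: "u * v - c = (u * v) div Q * Q" by (simp add: c_def minus_mod_eq_div_mult)
    have "poly (?l (u * v - c)) a = 0"
      unfolding quot map_poly_to_ac_mult using a by simp
    then have c_a: "poly (?l c) a = poly (?l (u * v)) a" by (simp add: map_poly_to_ac_diff)
    have "\<nu>bar (?l (u * v)) \<noteq> \<infinity> \<and>
      \<nu>bar (?l (u * v)) < \<nu>bar (?l (u * v) - [:poly (?l (u * v)) a:])"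
      by (rule value_minus_constant[OF valbar])
        (use uv fin low_roots in \<open>auto simp: map_poly_to_ac_eq_0_iff map_poly_to_ac_mult\<close>)
    then have prod: "\<nu> (u * v) < \<nu>bar (?l (u * v) - [:poly (?l c) a:])"
      by (simp add: ext c_a)
    then have prod_a: "\<nu>bar [:poly (?l c) a:] = \<nu> (u * v)"
      using valuation_diff_eq[OF valbar, of "?l (u * v)" "?l (u * v) - [:poly (?l c) a:]"]
      by (simp add: ext)
    have "\<nu> (u * v) < \<nu>bar (?l c - [:poly (?l c) a:])"
    proof (cases "c = 0")
      case True
      then show ?thesis
        using prod_a valuation_0[OF valbar] prod by (simp add: ext)
    next
      case False
      note low_c = low[OF False c]
      then have "\<nu>bar [:poly (?l c) a:] = \<nu> c"
        using valuation_diff_eq[OF valbar, of "?l c" "?l c - [:poly (?l c) a:]"] by (simp add: ext)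
      then show ?thesis using low_c prod_a by simp
    qed
    with prod have "\<nu> (u * v) < \<nu>bar ((?l (u * v) - [:poly (?l c) a:]) - (?l c - [:poly (?l c) a:]))"
      by (rule valuation_gt_diff[OF valbar])
    also have "(?l (u * v) - [:poly (?l c) a:]) - (?l c - [:poly (?l c) a:]) = ?l (u * v - c)"
      by (simp add: map_poly_to_ac_diff)
    finally show "\<nu> (u * v) < \<nu> ((u * v) div Q * Q)" by (simp only: ext quot)
  qed
qed

section \<open>Comparing truncations at two key polynomials\<close>

lemma degree_diff_monic:
  fixes p q :: "'k::field poly"
  assumes "lead_coeff p = 1" "lead_coeff q = 1" "Polynomial.degree p = Polynomial.degree q"
    "0 < Polynomial.degree q"
  shows "Polynomial.degree (p - q) < Polynomial.degree q"
proof (rule ccontr)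
  assume "\<not> Polynomial.degree (p - q) < Polynomial.degree q"
  moreover have "Polynomial.degree (p - q) \<le> Polynomial.degree q"
    using degree_diff_le_max[of p q] assms by simp
  ultimately have deg: "Polynomial.degree (p - q) = Polynomial.degree q" by simp
  have "lead_coeff (p - q) = 0" using assms by (simp add: deg)
  then have "p - q = 0" by (simp only: leading_coeff_0_iff)
  then show False using deg assms by simp
qed

text \<open>The key polynomial \<open>q\<close> lies beyond \<open>Q\<close>: it has larger degree, or the same degree and a larger value.\<close>

locale key_pair = lower: abstract_key_poly \<nu> Q + upper: abstract_key_poly \<nu> q
  for \<nu> :: "'k::field poly \<Rightarrow> 'g::linordered_ab_group_add extended" and Q q :: "'k poly" +
  assumes monic: "lead_coeff Q = 1" "lead_coeff q = 1"
    and order: "Polynomial.degree Q < Polynomial.degree q \<or>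
      Polynomial.degree Q = Polynomial.degree q \<and> \<nu> Q < \<nu> q"
begin

lemma low_imp_low: "Polynomial.degree g < Polynomial.degree Q \<Longrightarrow> Polynomial.degree g < Polynomial.degree q"
  using order by linarith

lemma value_Q_finite: "\<exists>\<beta>. \<nu> Q = Fin \<beta>"
proof -
  have "Q \<noteq> 0" using lower.deg_pos by auto
  then have "\<nu> Q \<noteq> \<infinity>" using order upper.finite_below[of Q] by auto
  then show ?thesis using valuation_not_Minf[OF lower.val] by (cases "\<nu> Q") auto
qed

text \<open>If the degrees agree, \<open>Q\<close> is replaced by \<open>Q - q\<close>, and the error \<open>q\<close> has a larger value than \<open>Q\<close>.\<close>

lemma Q_near_low:
  "\<exists>h. Polynomial.degree h < Polynomial.degree q \<and> \<nu> Q < upper.tr (Q - h) \<and> upper.tr h = \<nu> Q"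
proof (cases "Polynomial.degree Q < Polynomial.degree q")
  case True
  have "\<nu> Q \<noteq> \<infinity>" using value_Q_finite by auto
  then show ?thesis
    using True upper.tr_0 upper.tr_low by (intro exI[of _ Q]) (cases "\<nu> Q", auto)
next
  case False
  then have eq: "Polynomial.degree Q = Polynomial.degree q" and less: "\<nu> Q < \<nu> q"
    using order by auto
  have low: "Polynomial.degree (Q - q) < Polynomial.degree q"
    using degree_diff_monic[OF monic eq upper.deg_pos] .
  have "\<nu> (Q - q) = \<nu> Q" by (rule valuation_diff_eq[OF lower.val less])
  moreover have "upper.tr q = \<nu> q"
    using upper.tr_mult_q[of 1] upper.tr_low[of 1] upper.deg_pos valuation_1[OF upper.val] by simp
  ultimately show ?thesis
    using low less upper.tr_low[OF low] by (intro exI[of _ "Q - q"]) simp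
qed

lemma tr_upper_Q: "\<nu> Q \<le> upper.tr Q"
proof -
  obtain h where h: "\<nu> Q < upper.tr (Q - h)" "upper.tr h = \<nu> Q" using Q_near_low by blast
  then have "\<nu> Q \<le> upper.tr ((Q - h) + h)" by (intro upper.tr_ge_add) simp_all
  then show ?thesis by simp
qed

text \<open>In degree \<open>\<gamma>\<close> of the graded ring at \<open>q\<close>, the class of \<open>f\<close> is that of a polynomial of degree below
  that of \<open>q\<close>.\<close>

definition near :: "'g \<Rightarrow> 'k poly \<Rightarrow> bool" where
  "near \<gamma> f \<longleftrightarrow> Fin \<gamma> \<le> upper.tr f \<and>
     (\<exists>f0. Polynomial.degree f0 < Polynomial.degree q \<and> Fin \<gamma> < upper.tr (f - f0))"

lemma near_low:
  assumes "Polynomial.degree g < Polynomial.degree q" "Fin \<gamma> \<le> \<nu> g"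
  shows "near \<gamma> g"
  unfolding near_def using assms upper.tr_low[OF assms(1)] upper.tr_0
  by (auto intro!: exI[of _ g])

lemma near_Q: "\<nu> Q = Fin \<beta> \<Longrightarrow> near \<beta> Q"
  unfolding near_def using tr_upper_Q Q_near_low by auto

text \<open>The product of the two approximations may have too large a degree, but its quotient part modulo \<open>q\<close>
  is negligible.\<close>

lemma near_mult:
  assumes "near \<alpha> f" "near \<beta> g"
  shows "near (\<alpha> + \<beta>) (f * g)"
proof -
  obtain f0 where f: "Fin \<alpha> \<le> upper.tr f" "Polynomial.degree f0 < Polynomial.degree q"
    "Fin \<alpha> < upper.tr (f - f0)"
    using assms(1) by (auto simp: near_def)
  obtain g0 where g: "Fin \<beta> \<le> upper.tr g" "Polynomial.degree g0 < Polynomial.degree q"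
    "Fin \<beta> < upper.tr (g - g0)"
    using assms(2) by (auto simp: near_def)
  have f0: "Fin \<alpha> \<le> upper.tr f0"
    using upper.tr_ge_diff[of "Fin \<alpha>" f "f - f0"] f by simp
  have g0: "Fin \<beta> \<le> upper.tr g0"
    using upper.tr_ge_diff[of "Fin \<beta>" g "g - g0"] g by simp
  let ?c = "(f0 * g0) mod q" and ?d = "(f0 * g0) div q"
  note val = upper.valuation_tr
  have "Fin (\<alpha> + \<beta>) < upper.tr (?d * q)"
  proof (cases "f0 = 0 \<or> g0 = 0")
    case True
    then show ?thesis using upper.tr_0 by auto
  next
    case False
    have "Polynomial.degree ?d < Polynomial.degree q"
      using f(2) g(2) False upper.deg_pos by (intro degree_div_less) (simp_all add: degree_mult_eq)
    then have "upper.tr (?d * q) = \<nu> (?d * q)"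
      by (simp add: upper.tr_mult_q upper.tr_low valuation_mult[OF upper.val])
    moreover have "Fin (\<alpha> + \<beta>) \<le> \<nu> (f0 * g0)"
      using extended_add_ge_ge[OF f0 g0] f(2) g(2)
      by (simp add: upper.tr_low valuation_mult[OF upper.val])
    ultimately show ?thesis using upper.quotient_gt[of f0 g0] f g False by auto
  qed
  moreover have "Fin (\<alpha> + \<beta>) < upper.tr (f * (g - g0))"
    using extended_add_gt_ge[OF g(3) f(1)]
    by (simp add: valuation_mult[OF val] add.commute)
  moreover have "Fin (\<alpha> + \<beta>) < upper.tr ((f - f0) * g0)"
    using extended_add_gt_ge[OF f(3) g0] by (simp add: valuation_mult[OF val])
  ultimately have "Fin (\<alpha> + \<beta>) < upper.tr (f * (g - g0) + (f - f0) * g0 + ?d * q)"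
    by (intro valuation_gt_add[OF val])
  moreover have "f * (g - g0) + (f - f0) * g0 + ?d * q = f * g - ?c"
  proof -
    have "?d * q = f0 * g0 - ?c" by (simp add: minus_mod_eq_div_mult)
    moreover have "f * (g - g0) + (f - f0) * g0 + (f0 * g0 - c) = f * g - c" for c
      by (simp add: algebra_simps)
    ultimately show ?thesis by metis
  qed
  ultimately have "Fin (\<alpha> + \<beta>) < upper.tr (f * g - ?c)" by simp
  moreover have "Fin (\<alpha> + \<beta>) \<le> upper.tr (f * g)"
    using extended_add_ge_ge[OF f(1) g(1)] by (simp add: valuation_mult[OF val])
  ultimately show ?thesis
    unfolding near_def using upper.mod_degree by blast
qed

lemma near_mono:
  assumes "near \<beta> f" "\<alpha> \<le> \<beta>"
  shows "near \<alpha> f"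
proof -
  have "Fin \<alpha> \<le> Fin \<beta>" using assms(2) by simp
  then show ?thesis
    using assms(1) unfolding near_def by (meson order_trans le_less_trans)
qed

lemma near_add:
  assumes "near \<gamma> f" "near \<gamma> g"
  shows "near \<gamma> (f + g)"
proof -
  obtain f0 g0 where f: "Fin \<gamma> \<le> upper.tr f" "Polynomial.degree f0 < Polynomial.degree q"
    "Fin \<gamma> < upper.tr (f - f0)" and
    g: "Fin \<gamma> \<le> upper.tr g" "Polynomial.degree g0 < Polynomial.degree q"
    "Fin \<gamma> < upper.tr (g - g0)"
    using assms by (auto simp: near_def)
  have "Fin \<gamma> < upper.tr ((f - f0) + (g - g0))"
    using valuation_gt_add[OF upper.valuation_tr f(3) g(3)] .
  then have "Fin \<gamma> < upper.tr ((f + g) - (f0 + g0))" by (simp add: algebra_simps)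
  moreover have "Polynomial.degree (f0 + g0) < Polynomial.degree q"
    using f(2) g(2) by (rule degree_add_less)
  ultimately show ?thesis
    unfolding near_def using upper.tr_ge_add f(1) g(1) by blast
qed

lemma near_0: "near \<gamma> 0"
  by (rule near_low) (use upper.deg_pos valuation_0[OF upper.val] in simp_all)

lemma near_sum: "(\<And>i. i \<in> A \<Longrightarrow> near \<gamma> (f i)) \<Longrightarrow> near \<gamma> (sum f A)"
  by (induct A rule: infinite_finite_induct) (auto simp: near_0 near_add)

lemma near_power: "\<nu> (Q ^ i) = Fin \<gamma> \<Longrightarrow> near \<gamma> (Q ^ i)"
proof (induct i arbitrary: \<gamma>)
  case 0
  have "Polynomial.degree (1 :: 'k poly) < Polynomial.degree q" using upper.deg_pos by simp
  then show ?case using near_low[of 1 \<gamma>] 0 by simp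
next
  case (Suc i)
  obtain \<beta> where \<beta>: "\<nu> Q = Fin \<beta>" using value_Q_finite by blast
  obtain \<alpha> where \<alpha>: "\<nu> (Q ^ i) = Fin \<alpha>"
    using Suc.prems \<beta> valuation_mult[OF upper.val, of Q "Q ^ i"] by (cases "\<nu> (Q ^ i)") auto
  have "\<gamma> = \<beta> + \<alpha>"
    using Suc.prems valuation_mult[OF upper.val, of Q "Q ^ i"] \<alpha> \<beta> by simp
  then show ?case using near_mult[OF near_Q[OF \<beta>] Suc.hyps[OF \<alpha>]] by simp
qed

text \<open>In the \<open>Q\<close>-expansion of \<open>f\<close> the digits have low degree for \<open>q\<close> and \<open>Q\<close> is close to a polynomial
  of low degree; this passes to products and sums.\<close>

lemma lower_imp_near:
  assumes "Fin \<gamma> \<le> lower.tr f"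
  shows "near \<gamma> f"
proof -
  have "near \<gamma> (lower.digit f i * Q ^ i)" for i
  proof (cases "lower.digit f i = 0")
    case True
    then show ?thesis by (simp add: near_0)
  next
    case False
    have deg: "Polynomial.degree (lower.digit f i) < Polynomial.degree Q"
      by (rule q_expansion_degree[OF lower.deg_pos])
    obtain \<alpha> where \<alpha>: "\<nu> (lower.digit f i) = Fin \<alpha>"
      using lower.finite_below[OF False deg] valuation_not_Minf[OF lower.val]
      by (cases "\<nu> (lower.digit f i)") auto
    have "\<exists>\<beta>. \<nu> (Q ^ i) = Fin \<beta>"
    proof (induct i)
      case 0
      show ?case using valuation_1[OF lower.val] by (simp add: zero_extended_def)
    next
      case (Suc i)
      then show ?case using value_Q_finite by (auto simp: valuation_mult[OF lower.val])
    qed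
    then obtain \<beta> where \<beta>: "\<nu> (Q ^ i) = Fin \<beta>" by blast
    have "Fin \<gamma> \<le> Fin (\<alpha> + \<beta>)"
      using order_trans[OF assms lower.tr_le_digit[of f i]]
      by (simp add: valuation_mult[OF lower.val] \<alpha> \<beta>)
    then have "\<gamma> \<le> \<alpha> + \<beta>" by simp
    moreover have "near \<alpha> (lower.digit f i)"
      by (rule near_low) (use low_imp_low[OF deg] \<alpha> in simp_all)
    ultimately show ?thesis
      using near_mult[OF _ near_power[OF \<beta>]] near_mono by blast
  qed
  then have "near \<gamma> (\<Sum>i\<le>Polynomial.degree (q_expansion Q f). lower.digit f i * Q ^ i)"
    by (intro near_sum)
  then show ?thesis using q_expansion_sum[OF lower.deg_pos, of f] by simp
qed

lemma tr_mono: "lower.tr \<le> upper.tr"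
proof (rule le_funI)
  fix f
  have power: "\<nu> (Q ^ i) \<le> upper.tr (Q ^ i)" for i
  proof (induct i)
    case 0
    show ?case using upper.tr_low[of 1] upper.deg_pos by simp
  next
    case (Suc i)
    then show ?case
      using add_mono[OF tr_upper_Q Suc]
      by (simp add: valuation_mult[OF lower.val] valuation_mult[OF upper.valuation_tr])
  qed
  have "lower.tr f \<le> upper.tr (lower.digit f i * Q ^ i)" for i
  proof -
    have "lower.tr f \<le> \<nu> (lower.digit f i) + \<nu> (Q ^ i)"
      using lower.tr_le_digit[of f i] by (simp add: valuation_mult[OF lower.val])
    also have "\<dots> \<le> upper.tr (lower.digit f i) + upper.tr (Q ^ i)"
      using upper.tr_low[OF low_imp_low[OF q_expansion_degree[OF lower.deg_pos]]] power
      by (intro add_mono) simp_all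
    finally show ?thesis by (simp add: valuation_mult[OF upper.valuation_tr])
  qed
  then have "lower.tr f \<le> upper.tr (\<Sum>i\<le>Polynomial.degree (q_expansion Q f). lower.digit f i * Q ^ i)"
    by (intro upper.tr_sum)
  then show "lower.tr f \<le> upper.tr f"
    using q_expansion_sum[OF lower.deg_pos, of f] by simp
qed

text \<open>By the first assumption \<open>f\<close> is close to some \<open>f0\<close> of low degree, on which the truncation at \<open>q\<close> is
  exact. So the excess of \<open>\<nu> f\<close> over \<open>\<gamma>\<close> passes to \<open>f0\<close> and from there to the truncated value of \<open>f\<close>.\<close>

lemma tr_gt_if_value_gt:
  assumes "Fin \<gamma> \<le> lower.tr f" "Fin \<gamma> < \<nu> f"
  shows "Fin \<gamma> < upper.tr f"
proof -
  obtain f0 where f0: "Polynomial.degree f0 < Polynomial.degree q" "Fin \<gamma> < upper.tr (f - f0)"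
    using lower_imp_near[OF assms(1)] by (auto simp: near_def)
  have "Fin \<gamma> < \<nu> (f - f0)" using f0(2) upper.tr_le by (rule less_le_trans)
  from valuation_gt_diff[OF lower.val assms(2) this] have "Fin \<gamma> < \<nu> f0" by simp
  then have "Fin \<gamma> < upper.tr f0" using upper.tr_low[OF f0(1)] by simp
  then have "Fin \<gamma> < upper.tr ((f - f0) + f0)"
    using f0(2) by (intro valuation_gt_add[OF upper.valuation_tr])
  then show ?thesis by simp
qed

lemma remainder_close:
  assumes "Fin \<gamma> \<le> lower.tr f"
  shows "Fin \<gamma> < upper.tr (f - f mod q)"
proof -
  obtain f0 where f0: "Polynomial.degree f0 < Polynomial.degree q" "Fin \<gamma> < upper.tr (f - f0)"
    using lower_imp_near[OF assms(1)] by (auto simp: near_def)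
  have "upper.tr (f - f0) \<le> upper.tr ((f - f0) mod q)"
    using upper.tr_le_mod[of "f - f0"] upper.tr_low[OF upper.mod_degree] by simp
  then have "Fin \<gamma> < upper.tr ((f - f0) - (f - f0) mod q)"
    by (intro upper.tr_gt_diff[OF f0(2) less_le_trans[OF f0(2)]])
  moreover have "(f - f0) - (f - f0) mod q = f - f mod q"
    using f0(1) by (simp add: poly_mod_diff_left mod_poly_less)
  ultimately show ?thesis by simp
qed

end


section \<open>Limit key polynomials\<close>

text \<open>The set of key polynomials of degree \<open>n\<close> will be taken for \<open>S\<close>. From here on the extension of \<open>\<nu>\<close> to
  the algebraic closure has disappeared: only the abstract property of the members of \<open>S\<close> matters.\<close>

locale limit_key =
  fixes \<nu> :: "'k::field poly \<Rightarrow> 'g::linordered_ab_group_add extended" and S :: "'k poly set"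
    and n :: nat and Qn :: "'k poly"
  assumes keys: "\<And>Q. Q \<in> S \<Longrightarrow> abstract_key_poly \<nu> Q"
    and monic: "\<And>Q. Q \<in> S \<Longrightarrow> lead_coeff Q = 1"
    and degree: "\<And>Q. Q \<in> S \<Longrightarrow> Polynomial.degree Q = n"
    and nonempty: "S \<noteq> {}"
    and no_max: "\<And>Q. Q \<in> S \<Longrightarrow> \<exists>Q'\<in>S. \<nu> Q < \<nu> Q'"
    and limit: "limit_key_poly \<nu> S Qn"
begin

lemma val: "valuation \<nu>"
  using nonempty keys abstract_key_poly.val by blast

lemma pair: "Q \<in> S \<Longrightarrow> Q' \<in> S \<Longrightarrow> \<nu> Q < \<nu> Q' \<Longrightarrow> key_pair \<nu> Q Q'"
  using monic[of Q] monic[of Q']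
  by (intro key_pair.intro key_pair_axioms.intro) (auto simp: degree intro: keys)

lemma tr_mono: "Q \<in> S \<Longrightarrow> Q' \<in> S \<Longrightarrow> \<nu> Q < \<nu> Q' \<Longrightarrow> truncation \<nu> Q \<le> truncation \<nu> Q'"
  by (rule key_pair.tr_mono[OF pair])

lemma directed:
  assumes "Q \<in> S" "Q' \<in> S"
  shows "\<exists>P\<in>S. \<nu> Q < \<nu> P \<and> \<nu> Q' < \<nu> P"
proof (cases "\<nu> Q \<le> \<nu> Q'")
  case True
  then show ?thesis using no_max[OF assms(2)] by (meson le_less_trans)
next
  case False
  then show ?thesis using no_max[OF assms(1)] by (meson less_trans not_le)
qed

text \<open>By minimality of the degree of \<open>Qn\<close>, the polynomial \<open>f\<close> is not a candidate for a limit key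
  polynomial.\<close>

lemma eventually_exact:
  assumes "Polynomial.degree f < Polynomial.degree Qn"
  obtains Q where "Q \<in> S" "truncation \<nu> Q f = \<nu> f"
proof -
  have "f \<notin> limit_candidates \<nu> S"
    using limit assms unfolding limit_key_poly_def by (meson not_le)
  then obtain Q where Q: "Q \<in> S" "\<not> truncation \<nu> Q f < \<nu> f"
    by (auto simp: limit_candidates_def)
  then have "truncation \<nu> Q f = \<nu> f"
    using abstract_key_poly.tr_le[OF keys[OF Q(1)], of f] by simp
  with Q(1) show thesis by (rule that)
qed

lemma exact_mono:
  assumes "Q \<in> S" "P \<in> S" "\<nu> Q < \<nu> P" "truncation \<nu> Q f = \<nu> f"
  shows "truncation \<nu> P f = \<nu> f"
proof (rule antisym)
  show "truncation \<nu> P f \<le> \<nu> f" by (rule abstract_key_poly.tr_le[OF keys[OF assms(2)]])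
  show "\<nu> f \<le> truncation \<nu> P f"
    using le_funD[OF tr_mono[OF assms(1-3)], of f] assms(4) by simp
qed

lemma exact_two:
  assumes "Polynomial.degree f < Polynomial.degree Qn" "Polynomial.degree g < Polynomial.degree Qn"
  obtains Q where "Q \<in> S" "truncation \<nu> Q f = \<nu> f" "truncation \<nu> Q g = \<nu> g"
proof -
  obtain Q where Q: "Q \<in> S" "truncation \<nu> Q f = \<nu> f" by (rule eventually_exact[OF assms(1)])
  obtain Q' where Q': "Q' \<in> S" "truncation \<nu> Q' g = \<nu> g" by (rule eventually_exact[OF assms(2)])
  obtain P where P: "P \<in> S" "\<nu> Q < \<nu> P" "\<nu> Q' < \<nu> P" using directed[OF Q(1) Q'(1)] by blast
  show thesis
    using that[OF P(1) exact_mono[OF Q(1) P(1,2) Q(2)] exact_mono[OF Q'(1) P(1,3) Q'(2)]] .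
qed

lemma limit_gt: "Q \<in> S \<Longrightarrow> truncation \<nu> Q Qn < \<nu> Qn"
  using limit by (simp add: limit_key_poly_def limit_candidates_def)

lemma degree_Qn: "n \<le> Polynomial.degree Qn"
proof (rule ccontr)
  assume "\<not> n \<le> Polynomial.degree Qn"
  moreover obtain Q where Q: "Q \<in> S" using nonempty by blast
  ultimately have "truncation \<nu> Q Qn = \<nu> Qn"
    using abstract_key_poly.tr_low[OF keys[OF Q]] degree[OF Q] by simp
  then show False using limit_gt[OF Q] by simp
qed

lemma degree_Qn_pos: "0 < Polynomial.degree Qn"
proof -
  obtain Q where "Q \<in> S" using nonempty by blast
  then show ?thesis using degree_Qn degree abstract_key_poly.deg_pos[OF keys] by fastforce
qed

lemma value_finite: "Q \<in> S \<Longrightarrow> \<nu> Q \<noteq> \<infinity>"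
  using no_max by force

text \<open>In \<open>u v = c + d Qn\<close> all of \<open>u\<close>, \<open>v\<close>, \<open>c\<close>, \<open>d\<close> have degree below that of \<open>Qn\<close>, so a common truncation
  \<open>\<nu>\<^sub>Q\<close> is exact on them, whereas it is too small on \<open>Qn\<close> and therefore on \<open>d Qn\<close>. So the
  true value of \<open>d Qn = u v - c\<close> exceeds the minimum of the values of \<open>u v\<close> and \<open>c\<close>,
  which forces these two values to be equal. Non-zero polynomials of low degree have finite values since
  otherwise some \<open>Q\<close> in \<open>S\<close> would have an infinite, hence maximal, value.\<close>

lemma key_Qn: "abstract_key_poly \<nu> Qn"
proof
  show "valuation \<nu>" by (rule val)
  show deg: "0 < Polynomial.degree Qn" by (rule degree_Qn_pos)
  have finite_low: "\<nu> u \<noteq> \<infinity>" if u: "u \<noteq> 0" "Polynomial.degree u < Polynomial.degree Qn" for u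
  proof
    assume inf: "\<nu> u = \<infinity>"
    obtain Q where Q: "Q \<in> S" "truncation \<nu> Q u = \<nu> u" by (rule eventually_exact[OF u(2)])
    interpret Q: abstract_key_poly \<nu> Q by (rule keys[OF Q(1)])
    have "\<nu> (Q.digit u i * Q ^ i) = \<infinity>" for i
      using Q.tr_le_digit[of u i] Q(2) inf by simp
    moreover have "\<nu> (Q ^ i) \<noteq> \<infinity>" for i
    proof (induct i)
      case (Suc i)
      then show ?case
        using value_finite[OF Q(1)] by (cases "\<nu> Q"; cases "\<nu> (Q ^ i)") (auto simp: valuation_mult[OF val])
    qed (simp add: valuation_1[OF val] zero_extended_def)
    ultimately have "\<nu> (Q.digit u i) + \<nu> (Q ^ i) = \<infinity>" "\<nu> (Q ^ i) \<noteq> \<infinity>" for i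
      using valuation_mult[OF val] by metis+
    note finite_power = this
    have "\<nu> (Q.digit u i) = \<infinity>" for i
      using finite_power[of i] valuation_not_Minf[OF val, of "Q.digit u i"] valuation_not_Minf[OF val, of "Q ^ i"]
      by (cases "\<nu> (Q.digit u i)"; cases "\<nu> (Q ^ i)") auto
    then have "Q.digit u i = 0" for i
      using Q.finite_below q_expansion_degree[OF Q.deg_pos] by blast
    then have "q_expansion Q u = 0" by (simp add: poly_eq_iff)
    then show False using q_expansion_poly[OF Q.deg_pos, of u] u(1) by simp
  qed
  then show "\<nu> u \<noteq> \<infinity>" if "u \<noteq> 0" "Polynomial.degree u < Polynomial.degree Qn" for u
    using that .
  fix u v :: "'k poly"
  assume u: "u \<noteq> 0" "Polynomial.degree u < Polynomial.degree Qn"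
    and v: "v \<noteq> 0" "Polynomial.degree v < Polynomial.degree Qn"
  define c where "c = (u * v) mod Qn"
  define d where "d = (u * v) div Qn"
  have c: "Polynomial.degree c < Polynomial.degree Qn"
    unfolding c_def by (rule degree_mod_less_pos[OF deg])
  have d: "Polynomial.degree d < Polynomial.degree Qn"
    unfolding d_def using u v deg by (intro degree_div_less) (simp_all add: degree_mult_eq)
  have uv: "d * Qn = u * v - c" by (simp add: c_def d_def minus_mod_eq_div_mult)
  obtain x where x: "\<nu> (u * v) = Fin x"
    using finite_low[OF u] finite_low[OF v] valuation_not_Minf[OF val, of u]
      valuation_not_Minf[OF val, of v]
    by (cases "\<nu> u"; cases "\<nu> v") (auto simp: valuation_mult[OF val])
  have "\<nu> (u * v) < \<nu> (d * Qn)"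
  proof (cases "d = 0")
    case True
    then show ?thesis by (simp add: x valuation_0[OF val])
  next
    case False
    obtain y where y: "\<nu> d = Fin y"
      using finite_low[OF False d] valuation_not_Minf[OF val, of d] by (cases "\<nu> d") auto
    obtain Q1 where Q1: "Q1 \<in> S" "truncation \<nu> Q1 u = \<nu> u" "truncation \<nu> Q1 v = \<nu> v"
      by (rule exact_two[OF u(2) v(2)])
    obtain Q2 where Q2: "Q2 \<in> S" "truncation \<nu> Q2 c = \<nu> c" "truncation \<nu> Q2 d = \<nu> d"
      by (rule exact_two[OF c d])
    obtain Q where Q: "Q \<in> S" "\<nu> Q1 < \<nu> Q" "\<nu> Q2 < \<nu> Q"
      using directed[OF Q1(1) Q2(1)] by blast
    interpret Q: abstract_key_poly \<nu> Q by (rule keys[OF Q(1)])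
    note exact = exact_mono[OF Q1(1) Q(1,2) Q1(2)] exact_mono[OF Q1(1) Q(1,2) Q1(3)]
      exact_mono[OF Q2(1) Q(1,3) Q2(2)] exact_mono[OF Q2(1) Q(1,3) Q2(3)]
    have prod: "Q.tr (u * v) = \<nu> (u * v)"
      by (simp add: valuation_mult[OF Q.valuation_tr] valuation_mult[OF val] exact)
    have "Q.tr (d * Qn) < \<nu> (d * Qn)"
      using limit_gt[OF Q(1)] y valuation_not_Minf[OF Q.valuation_tr, of Qn]
      by (cases "\<nu> Qn"; cases "Q.tr Qn")
        (auto simp: valuation_mult[OF Q.valuation_tr] valuation_mult[OF val] exact)
    moreover have "min (\<nu> (u * v)) (\<nu> c) \<le> Q.tr (d * Qn)"
      using valuation_diff[OF Q.valuation_tr, of "u * v" c] by (simp add: uv prod exact)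
    ultimately have less: "min (\<nu> (u * v)) (\<nu> c) < \<nu> (u * v - c)" by (simp add: uv)
    \<comment> \<open>a sum has a value above the minimum only if both terms have the same value\<close>
    have "\<nu> (u * v) = \<nu> c"
    proof (rule ccontr)
      assume "\<nu> (u * v) \<noteq> \<nu> c"
      then consider "\<nu> (u * v) < \<nu> c" | "\<nu> c < \<nu> (u * v)" by (meson linorder_neqE)
      then show False
      proof cases
        case 1
        then show False using less valuation_diff_eq[OF val 1] by (simp add: min_def split: if_splits)
      next
        case 2
        have "\<nu> (u * v - c) = \<nu> (c - u * v)"
          using valuation_uminus[OF val, of "c - u * v"] by simp
        then show False using less valuation_diff_eq[OF val 2] 2 by (simp add: min_def split: if_splits)
      qed
    qed
    then show ?thesis using less by (simp add: uv)
  qed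
  then show "\<nu> (u * v) < \<nu> ((u * v) div Qn * Qn)" by (simp only: d_def)
qed

text \<open>If \<open>Qn\<close> has degree \<open>n\<close> too and does not have a larger value than \<open>Q\<close>, then expanding \<open>Qn = (Qn - Q) + Q\<close>
  shows that the truncation at \<open>Q\<close> is exact on \<open>Qn\<close>, contrary to the choice of \<open>Qn\<close>.\<close>

lemma pair_Qn:
  assumes Q: "Q \<in> S"
  shows "key_pair \<nu> Q Qn"
proof (intro key_pair.intro key_pair_axioms.intro)
  show "abstract_key_poly \<nu> Q" "lead_coeff Q = 1" using keys monic Q by blast+
  show "abstract_key_poly \<nu> Qn" by (rule key_Qn)
  show "lead_coeff Qn = 1" using limit by (simp add: limit_key_poly_def)
  show "Polynomial.degree Q < Polynomial.degree Qn \<or>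
    Polynomial.degree Q = Polynomial.degree Qn \<and> \<nu> Q < \<nu> Qn"
  proof (cases "Polynomial.degree Qn = n")
    case False
    then show ?thesis using degree_Qn degree[OF Q] by simp
  next
    case True
    interpret Q: abstract_key_poly \<nu> Q by (rule keys[OF Q])
    have "\<nu> Q < \<nu> Qn"
    proof (rule ccontr)
      assume "\<not> \<nu> Q < \<nu> Qn"
      then have le: "\<nu> Qn \<le> \<nu> Q" by simp
      have low: "Polynomial.degree (Qn - Q) < Polynomial.degree Q"
        by (rule degree_diff_monic) (use monic[OF Q] degree[OF Q] True limit Q.deg_pos in \<open>simp_all add: limit_key_poly_def\<close>)
      have "\<nu> Qn \<le> Q.tr (Qn - Q)"
        using valuation_ge_diff[OF val order_refl le] Q.tr_low[OF low] by simp
      moreover have "Q.tr Q = \<nu> Q"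
        using Q.tr_mult_q[of 1] Q.tr_low[of 1] Q.deg_pos valuation_1[OF val] by simp
      ultimately have "\<nu> Qn \<le> Q.tr ((Qn - Q) + Q)" using le by (intro Q.tr_ge_add) simp_all
      then show False using limit_gt[OF Q] by simp
    qed
    then show ?thesis using True degree[OF Q] by simp
  qed
qed

end

section \<open>The limit of the graded rings\<close>

context limit_key
begin

abbreviation "rees_at Q \<equiv> valued_ring.rees (truncation \<nu> Q)"
abbreviation "class_at Q \<equiv> valued_ring.graded_class (truncation \<nu> Q)"
abbreviation "L \<equiv> truncation_limit \<nu> S"
abbreviation "G \<equiv> graded_ring (truncation \<nu> Qn)"
abbreviation "rees_limit \<equiv> \<Union>Q\<in>S. rees_at Q"

lemma valued_at: "Q \<in> S \<Longrightarrow> valued_ring (truncation \<nu> Q)"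
  by (rule valued_ring.intro[OF abstract_key_poly.valuation_tr[OF keys]])

sublocale Qn: abstract_key_poly \<nu> Qn
  by (rule key_Qn)

sublocale top: valued_ring "truncation \<nu> Qn"
  by (rule valued_ring.intro[OF Qn.valuation_tr])

lemma coarser: "Q \<in> S \<Longrightarrow> Q' \<in> S \<Longrightarrow> truncation \<nu> Q \<le> truncation \<nu> Q' \<Longrightarrow>
    coarser_valuation (truncation \<nu> Q) (truncation \<nu> Q')"
  by (intro coarser_valuation.intro coarser_valuation_axioms.intro valued_at)

lemma coarser_top: "Q \<in> S \<Longrightarrow> coarser_valuation (truncation \<nu> Q) (truncation \<nu> Qn)"
  by (intro coarser_valuation.intro coarser_valuation_axioms.intro valued_at
      top.valued_ring_axioms key_pair.tr_mono[OF pair_Qn])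

sublocale system: presented_system S "\<lambda>Q Q'. truncation \<nu> Q \<le> truncation \<nu> Q'"
  "\<lambda>Q. graded_ring (truncation \<nu> Q)" "\<lambda>Q Q'. graded_map (truncation \<nu> Q) (truncation \<nu> Q')"
  rees_at class_at
proof (rule presented_system.intro)
  show "S \<noteq> {}" by (rule nonempty)
  show "\<exists>P\<in>S. truncation \<nu> Q \<le> truncation \<nu> P \<and> truncation \<nu> Q' \<le> truncation \<nu> P"
    if "Q \<in> S" "Q' \<in> S" for Q Q'
    using directed[OF that] tr_mono that by meson
  show "ring_presentation (rees_at Q) (class_at Q) (graded_ring (truncation \<nu> Q))" if "Q \<in> S" for Q
    by (rule valued_ring.graded_presentation[OF valued_at[OF that]])
  show "rees_at Q \<subseteq> rees_at Q'"
    if "Q \<in> S" "Q' \<in> S" "truncation \<nu> Q \<le> truncation \<nu> Q'" for Q Q'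
    by (rule coarser_valuation.rees_mono[OF coarser[OF that]])
  show "graded_map (truncation \<nu> Q) (truncation \<nu> Q') (class_at Q r) = class_at Q' r"
    if "Q \<in> S" "Q' \<in> S" "truncation \<nu> Q \<le> truncation \<nu> Q'" "r \<in> rees_at Q" for Q Q' r
    by (rule coarser_valuation.graded_map_class[OF coarser[OF that(1-3)] that(4)])
qed (auto intro: order_trans)

sublocale lim: ring_presentation rees_limit system.limit_class L
  unfolding truncation_limit_def by (rule system.limit_presentation)

sublocale pres: ring_presentation top.rees top.graded_class G
  by (rule top.graded_presentation)

lemma rees_limit_subset: "rees_limit \<subseteq> top.rees"
  using coarser_valuation.rees_mono[OF coarser_top] by blast

text \<open>The two kernels on the union of the Rees rings agree. If the class of \<open>r\<close> vanishes at \<open>Qn\<close>, the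
  entries of \<open>r\<close> have too large values under \<open>\<nu>\<close>, not just under the truncation at \<open>Qn\<close>. The
  truncation at any \<open>P\<close> beyond a stage that contains \<open>r\<close> then already has this property.\<close>

lemma kernel:
  assumes "r \<in> rees_limit"
  shows "system.limit_class r = \<zero>\<^bsub>L\<^esub> \<longleftrightarrow> top.graded_class r = \<zero>\<^bsub>G\<^esub>"
proof -
  obtain Q where Q: "Q \<in> S" "r \<in> rees_at Q" using assms by blast
  have "system.limit_class r = \<zero>\<^bsub>L\<^esub> \<longleftrightarrow>
    (\<exists>P\<in>S. truncation \<nu> Q \<le> truncation \<nu> P \<and> class_at P r = \<zero>\<^bsub>graded_ring (truncation \<nu> P)\<^esub>)"
    unfolding truncation_limit_def by (rule system.limit_class_zero_iff[OF Q])
  also have "\<dots> \<longleftrightarrow> (\<exists>P\<in>S. truncation \<nu> Q \<le> truncation \<nu> P \<and>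
      (\<forall>\<gamma>. Poly_Mapping.lookup r \<gamma> \<in> P_gt (truncation \<nu> P) \<gamma>))"
    using Q(2) system.A_mono[OF Q(1)]
    by (intro bex_cong refl conj_cong) (auto simp: valued_ring.graded_class_zero_iff[OF valued_at] subset_iff)
  also have "\<dots> \<longleftrightarrow> (\<forall>\<gamma>. Poly_Mapping.lookup r \<gamma> \<in> P_gt (truncation \<nu> Qn) \<gamma>)"
  proof
    assume "\<exists>P\<in>S. truncation \<nu> Q \<le> truncation \<nu> P \<and>
      (\<forall>\<gamma>. Poly_Mapping.lookup r \<gamma> \<in> P_gt (truncation \<nu> P) \<gamma>)"
    then show "\<forall>\<gamma>. Poly_Mapping.lookup r \<gamma> \<in> P_gt (truncation \<nu> Qn) \<gamma>"
      using coarser_valuation.gt_mono[OF coarser_top] by blast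
  next
    assume gt: "\<forall>\<gamma>. Poly_Mapping.lookup r \<gamma> \<in> P_gt (truncation \<nu> Qn) \<gamma>"
    obtain P where P: "P \<in> S" "\<nu> Q < \<nu> P" using no_max[OF Q(1)] by blast
    have "Poly_Mapping.lookup r \<gamma> \<in> P_gt (truncation \<nu> P) \<gamma>" for \<gamma>
    proof -
      have "Fin \<gamma> \<le> truncation \<nu> Q (Poly_Mapping.lookup r \<gamma>)"
        using valued_ring.lookup_in_ge[OF valued_at[OF Q(1)] Q(2)] by (simp add: P_ge_def)
      moreover have "Fin \<gamma> < \<nu> (Poly_Mapping.lookup r \<gamma>)"
        using gt Qn.tr_le by (auto simp: P_gt_def intro: less_le_trans)
      ultimately show ?thesis
        using key_pair.tr_gt_if_value_gt[OF pair[OF Q(1) P]] by (simp add: P_gt_def)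
    qed
    then show "\<exists>P\<in>S. truncation \<nu> Q \<le> truncation \<nu> P \<and>
      (\<forall>\<gamma>. Poly_Mapping.lookup r \<gamma> \<in> P_gt (truncation \<nu> P) \<gamma>)"
      using P tr_mono[OF Q(1) P] by blast
  qed
  also have "\<dots> \<longleftrightarrow> top.graded_class r = \<zero>\<^bsub>G\<^esub>"
    using top.graded_class_zero_iff assms rees_limit_subset by blast
  finally show ?thesis .
qed

lemma single_in_limit:
  assumes "Polynomial.degree f < Polynomial.degree Qn" "Fin \<gamma> \<le> \<nu> f"
  shows "Poly_Mapping.single \<gamma> f \<in> rees_limit"
proof -
  obtain Q where "Q \<in> S" "truncation \<nu> Q f = \<nu> f" by (rule eventually_exact[OF assms(1)])
  then show ?thesis
    using assms(2) valued_ring.single_in_rees[OF valued_at, of Q f \<gamma>] by (auto simp: P_ge_def)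
qed

text \<open>Passing to the remainders modulo \<open>Qn\<close> changes the entries by negligible terms only, because every
  entry is close to a polynomial of low degree.\<close>

lemma low_representative:
  assumes "r \<in> rees_limit"
  obtains s where "s \<in> rees_limit" "top.graded_class s = top.graded_class r"
    "\<And>\<gamma>. Polynomial.degree (Poly_Mapping.lookup s \<gamma>) < Polynomial.degree Qn"
proof -
  obtain Q where Q: "Q \<in> S" "r \<in> rees_at Q" using assms by blast
  define s where "s = Poly_Mapping.map (\<lambda>f. f mod Qn) r"
  have s: "Poly_Mapping.lookup s \<gamma> = Poly_Mapping.lookup r \<gamma> mod Qn" for \<gamma>
    by (simp add: s_def Poly_Mapping.map.rep_eq when_def)
  have deg: "Polynomial.degree (Poly_Mapping.lookup s \<gamma>) < Polynomial.degree Qn" for \<gamma>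
    unfolding s by (rule Qn.mod_degree)
  have r_ge: "Fin \<gamma> \<le> truncation \<nu> Q (Poly_Mapping.lookup r \<gamma>)" for \<gamma>
    using valued_ring.lookup_in_ge[OF valued_at[OF Q(1)] Q(2)] by (simp add: P_ge_def)
  have gt: "Fin \<gamma> < truncation \<nu> Qn (Poly_Mapping.lookup r \<gamma> - Poly_Mapping.lookup s \<gamma>)" for \<gamma>
    unfolding s by (rule key_pair.remainder_close[OF pair_Qn[OF Q(1)] r_ge])
  have "Fin \<gamma> \<le> \<nu> (Poly_Mapping.lookup s \<gamma>)" for \<gamma>
    using Qn.tr_le_mod[of "Poly_Mapping.lookup r \<gamma>"] r_ge[of \<gamma>]
      le_funD[OF key_pair.tr_mono[OF pair_Qn[OF Q(1)]]] unfolding s by (meson order_trans)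
  then have "(\<Sum>\<gamma>\<in>Poly_Mapping.keys s. Poly_Mapping.single \<gamma> (Poly_Mapping.lookup s \<gamma>)) \<in> rees_limit"
    by (intro lim.sum_in single_in_limit deg)
  then have s_in: "s \<in> rees_limit" by (simp add: sum_singles)
  have "top.graded_class s = top.graded_class r"
    using top.graded_class_eq_iff[OF subsetD[OF rees_limit_subset assms] subsetD[OF rees_limit_subset s_in]]
      gt by (simp add: P_gt_def)
  with s_in deg that show thesis by blast
qed

lemma low_degree_carrier: "carrier (low_degree_ring \<nu> Qn) = top.graded_class ` rees_limit"
proof -
  let ?I = "initial_form (truncation \<nu> Qn) ` {f. Polynomial.degree f < Polynomial.degree Qn}"
  interpret cring G by (rule pres.is_cring)
  have sub: "?I \<subseteq> top.graded_class ` rees_limit"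
  proof
    fix x assume "x \<in> ?I"
    then obtain f where f: "Polynomial.degree f < Polynomial.degree Qn"
      "x = initial_form (truncation \<nu> Qn) f" by blast
    show "x \<in> top.graded_class ` rees_limit"
    proof (cases "\<nu> f")
      case (Fin \<gamma>)
      then have "Poly_Mapping.single \<gamma> f \<in> rees_limit" using single_in_limit[OF f(1)] by simp
      moreover have "x = top.graded_class (Poly_Mapping.single \<gamma> f)"
        using f Fin Qn.tr_low[OF f(1)] top.initial_form_eq by simp
      ultimately show ?thesis by blast
    next
      case Pinf
      then have "x = top.graded_class 0"
        using f Qn.tr_low[OF f(1)] top.initial_form_infinite pres.zero_eq by simp
      then show ?thesis using lim.zero_in by blast
    next
      case Minf
      then show ?thesis using valuation_not_Minf[OF val] by blast
    qed
  qed
  have "subgroup (top.graded_class ` rees_limit) (add_monoid G)"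
  proof (rule add.subgroupI)
    show "top.graded_class ` rees_limit \<subseteq> carrier G"
      using pres.closed rees_limit_subset by auto
    show "top.graded_class ` rees_limit \<noteq> {}" using lim.zero_in by blast
    fix a assume "a \<in> top.graded_class ` rees_limit"
    then obtain r where r: "r \<in> rees_limit" "a = top.graded_class r" by blast
    have inverse: "top.graded_class (- r) \<oplus>\<^bsub>G\<^esub> top.graded_class r = \<zero>\<^bsub>G\<^esub>"
      using pres.add_eq[OF subsetD[OF rees_limit_subset lim.uminus_in[OF r(1)]]
          subsetD[OF rees_limit_subset r(1)]] pres.zero_eq by simp
    have "\<ominus>\<^bsub>G\<^esub> a = top.graded_class (- r)"
      unfolding r(2)
      by (rule minus_equality[OF inverse])
        (use pres.closed r(1) lim.uminus_in[OF r(1)] rees_limit_subset in blast)+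
    then show "\<ominus>\<^bsub>G\<^esub> a \<in> top.graded_class ` rees_limit"
      using lim.uminus_in[OF r(1)] by auto
  next
    fix a b assume "a \<in> top.graded_class ` rees_limit" "b \<in> top.graded_class ` rees_limit"
    then obtain r s where rs: "r \<in> rees_limit" "a = top.graded_class r" "s \<in> rees_limit"
      "b = top.graded_class s"
      by blast
    then show "a \<oplus>\<^bsub>G\<^esub> b \<in> top.graded_class ` rees_limit"
      using lim.add_in[OF rs(1,3)] by (simp add: rs(2,4) top.graded_class_add[symmetric])
  qed
  then have "generate (add_monoid G) ?I \<subseteq> top.graded_class ` rees_limit"
    using add.generate_subgroup_incl[OF sub] by simp
  moreover have "top.graded_class r \<in> generate (add_monoid G) ?I" if r: "r \<in> rees_limit" for r
  proof -
    obtain s where s: "s \<in> rees_limit" "top.graded_class s = top.graded_class r"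
      "\<And>\<gamma>. Polynomial.degree (Poly_Mapping.lookup s \<gamma>) < Polynomial.degree Qn"
      using low_representative[OF r] by metis
    let ?s = "\<lambda>\<gamma>. Poly_Mapping.single \<gamma> (Poly_Mapping.lookup s \<gamma>)"
    have s_ge: "Poly_Mapping.lookup s \<gamma> \<in> P_ge (truncation \<nu> Qn) \<gamma>" for \<gamma>
      using top.lookup_in_ge s(1) rees_limit_subset by blast
    have single: "top.graded_class (?s \<gamma>) \<in> generate (add_monoid G) ?I" for \<gamma>
    proof (cases "truncation \<nu> Qn (Poly_Mapping.lookup s \<gamma>) = Fin \<gamma>")
      case True
      from top.initial_form_eq[OF this, symmetric] show ?thesis
        using s(3) by (intro generate.incl) (simp only: image_eqI mem_Collect_eq)
    next
      case False
      then have "top.graded_class (?s \<gamma>) = \<zero>\<^bsub>G\<^esub>"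
        using s_ge[of \<gamma>] by (intro top.single_class_zero) (auto simp: P_ge_def P_gt_def)
      then show ?thesis using generate.one[of "add_monoid G"] by simp
    qed
    have "top.graded_class (sum ?s K) \<in> generate (add_monoid G) ?I" if "finite K" for K
      using that
    proof (induct K)
      case empty
      then show ?case using generate.one[of "add_monoid G"] pres.zero_eq by simp
    next
      case (insert \<gamma> K)
      then show ?case
        using generate.eng[OF single[of \<gamma>] insert.hyps(3)] by (simp add: top.graded_class_add)
    qed
    from this[OF finite_keys[of s]] show ?thesis using s(2) by (simp add: sum_singles)
  qed
  ultimately show ?thesis by (auto simp: low_degree_ring_def)
qed

lemma low_degree_presentation:
  "ring_presentation rees_limit top.graded_class (low_degree_ring \<nu> Qn)"
proof
  show "carrier (low_degree_ring \<nu> Qn) = top.graded_class ` rees_limit"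
    by (rule low_degree_carrier)
qed (use rees_limit_subset pres.add_eq pres.mult_eq pres.one_eq pres.zero_eq lim.one_in
    lim.diff_in lim.mult_in in \<open>auto simp: low_degree_ring_def subset_iff\<close>)

theorem limit_iso_low_degree_ring: "L \<simeq> low_degree_ring \<nu> Qn"
  by (rule lim.isomorphic[OF low_degree_presentation])
    (use kernel in \<open>simp add: low_degree_ring_def\<close>)

end


section \<open>The polynomial ring over the limit\<close>

lemma lookup_mult_single:
  fixes r :: "'g::ab_group_add \<Rightarrow>\<^sub>0 'a::comm_ring_1"
  shows "Poly_Mapping.lookup (r * Poly_Mapping.single \<beta> f) \<gamma> = Poly_Mapping.lookup r (\<gamma> - \<beta>) * f"
proof -
  have "r * Poly_Mapping.single \<beta> f =
      (\<Sum>\<alpha> \<in> Poly_Mapping.keys r. Poly_Mapping.single (\<alpha> + \<beta>) (Poly_Mapping.lookup r \<alpha> * f))"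
    by (subst sum_singles[of r, symmetric]) (simp add: sum_distrib_right mult_single)
  also have "Poly_Mapping.lookup \<dots> \<gamma> =
      (\<Sum>\<alpha> \<in> Poly_Mapping.keys r. if \<alpha> = \<gamma> - \<beta> then Poly_Mapping.lookup r \<alpha> * f else 0)"
    unfolding lookup_sum by (rule sum.cong) (auto simp: lookup_single when_def)
  also have "\<dots> = Poly_Mapping.lookup r (\<gamma> - \<beta>) * f"
    by (simp add: in_keys_iff)
  finally show ?thesis .
qed

lemma single_power: "Poly_Mapping.single \<beta> f ^ i = Poly_Mapping.single (\<Sum>j<i. \<beta>) (f ^ i)"
  by (induct i) (simp_all add: mult_single add.commute)

lemma low_degree_expansion:
  fixes q :: "'k::field poly"
  assumes "0 < Polynomial.degree q" "\<And>i. Polynomial.degree (f i) < Polynomial.degree q"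
  shows "Polynomial.coeff (q_expansion q (\<Sum>i\<le>d. f i * q ^ i)) i = (if i \<le> d then f i else 0)"
proof -
  let ?F = "\<Sum>i\<le>d. Polynomial.monom (f i) i"
  have coeff: "Polynomial.coeff ?F i = (if i \<le> d then f i else 0)" for i
    by (simp add: Polynomial.coeff_sum)
  have "q_expansion q (\<Sum>i\<le>d. f i * q ^ i) = ?F"
    by (rule q_expansion_unique) (auto simp: poly_sum poly_monom coeff assms)
  then show ?thesis by (simp add: coeff)
qed

context limit_key
begin

text \<open>The indeterminate is sent to the initial form of \<open>Qn\<close>. If the coefficients are represented by
  families with entries of degree below that of \<open>Qn\<close>, the entries of the image are \<open>Qn\<close>-expansions whose
  digits are these entries. As the truncated value is the minimum over the digits, the image
  vanishes only if all coefficients do. Conversely, the digits of a homogeneous representative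
  provide coefficients of a preimage.\<close>

theorem graded_ring_iso_polynomials:
  assumes "\<nu> Qn \<noteq> \<infinity>"
  shows "G \<simeq> UP L"
proof -
  obtain b where b: "\<nu> Qn = Fin b"
    using assms valuation_not_Minf[OF val] by (cases "\<nu> Qn") auto
  \<comment> \<open>\<open>Y\<close> represents the initial form of \<open>Qn\<close>, and \<open>c i\<close> is the value of the \<open>i\<close>-th power of \<open>Qn\<close>\<close>
  define Y where "Y = Poly_Mapping.single b Qn"
  define c where "c i = (\<Sum>j<i. b)" for i :: nat
  have Y_power: "Y ^ i = Poly_Mapping.single (c i) (Qn ^ i)" for i
    unfolding Y_def c_def by (rule single_power)
  have c: "\<nu> (Qn ^ i) = Fin (c i)" for i
  proof (induct i)
    case 0
    show ?case using valuation_1[OF val] by (simp add: c_def zero_extended_def)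
  next
    case (Suc i)
    then show ?case by (simp add: valuation_mult[OF val] b c_def add.commute)
  qed
  have "truncation \<nu> Qn Qn = Fin b"
    using Qn.tr_mult_q[of 1] Qn.tr_low[of 1] Qn.deg_pos valuation_1[OF val] b by simp
  then have Y: "Y \<in> top.rees"
    unfolding Y_def by (intro top.single_in_rees) (simp add: P_ge_def)
  obtain h where h: "h \<in> ring_hom L G" "\<And>r. r \<in> rees_limit \<Longrightarrow> h (system.limit_class r) = top.graded_class r"
    by (rule lim.induced_hom[OF top.graded_presentation rees_limit_subset]) (use kernel in auto)
  have pre: "UP_pre_univ_prop L G h"
    by (intro UP_pre_univ_prop.intro ring_hom_cringI UP_cring.intro lim.is_cring pres.is_cring h(1))
  interpret G: cring G by (rule pres.is_cring)
  interpret U: UP_pre_univ_prop L G h "UP L"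
    using pre by simp
  define y where "y = top.graded_class Y"
  have y: "y \<in> carrier G" unfolding y_def by (rule pres.closed[OF Y])
  have y_power: "y [^]\<^bsub>G\<^esub> i = top.graded_class (Y ^ i)" for i :: nat
    unfolding y_def by (rule pres.power_eq[OF Y, symmetric])
  let ?E = "eval L G h y"
  have E: "?E \<in> ring_hom (UP L) G" by (rule U.eval_ring_hom[OF y])
  interpret E: ring_hom_cring "UP L" G ?E
    by (rule U.ring_homD[OF E])
  have injective: "p = \<zero>\<^bsub>UP L\<^esub>" if p: "p \<in> carrier (UP L)" "?E p = \<zero>\<^bsub>G\<^esub>" for p
  proof -
    let ?p = "up_ring.coeff (UP L) p"
    have "\<exists>r s. r \<in> rees_limit \<and> ?p i = system.limit_class r \<and> s \<in> rees_limit \<and>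
        top.graded_class s = top.graded_class r \<and>
        (\<forall>\<gamma>. Polynomial.degree (Poly_Mapping.lookup s \<gamma>) < Polynomial.degree Qn)" for i
    proof -
      have "?p i \<in> carrier L" using p(1) by (rule U.coeff_closed)
      then obtain r where r: "r \<in> rees_limit" "?p i = system.limit_class r"
        unfolding lim.carrier_eq by blast
      obtain s where "s \<in> rees_limit" "top.graded_class s = top.graded_class r"
        "\<And>\<gamma>. Polynomial.degree (Poly_Mapping.lookup s \<gamma>) < Polynomial.degree Qn"
        using low_representative[OF r(1)] by metis
      with r show ?thesis by blast
    qed
    then obtain r s where r: "\<And>i. r i \<in> rees_limit" "\<And>i. ?p i = system.limit_class (r i)"
      and s: "\<And>i. s i \<in> rees_limit" "\<And>i. top.graded_class (s i) = top.graded_class (r i)"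
        "\<And>i \<gamma>. Polynomial.degree (Poly_Mapping.lookup (s i) \<gamma>) < Polynomial.degree Qn"
      by metis
    have s_top: "s i \<in> top.rees" for i using s(1) rees_limit_subset by blast
    have in_top: "s i * Y ^ i \<in> top.rees" for i
      by (intro pres.mult_in pres.power_in s_top Y)
    let ?d = "deg L p"
    have term_eq: "h (?p i) \<otimes>\<^bsub>G\<^esub> y [^]\<^bsub>G\<^esub> i = top.graded_class (s i * Y ^ i)" for i
      using pres.mult_eq[OF s_top pres.power_in[OF Y], of i i] h(2)[OF r(1)] s(2)
      by (simp add: r(2) y_power)
    have "?E p = (\<Oplus>\<^bsub>G\<^esub> i \<in> {..?d}. top.graded_class (s i * Y ^ i))"
      using U.eval_on_carrier[OF p(1), of G h y] by (simp add: term_eq)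
    also have "\<dots> = top.graded_class (\<Sum>i\<le>?d. s i * Y ^ i)"
      by (rule pres.sum_eq[symmetric]) (rule in_top)
    finally have zero: "Poly_Mapping.lookup (\<Sum>i\<le>?d. s i * Y ^ i) \<gamma> \<in> P_gt (truncation \<nu> Qn) \<gamma>" for \<gamma>
      using top.graded_class_zero_iff[OF pres.sum_in[of "{..?d}" "\<lambda>i. s i * Y ^ i", OF in_top]] p(2) by simp
    have "?p i = \<zero>\<^bsub>L\<^esub>" for i
    proof (cases "i \<le> ?d")
      case False
      then show ?thesis using U.deg_aboveD[OF _ p(1)] by simp
    next
      case True
      \<comment> \<open>the entry of \<open>s i\<close> at \<open>\<beta>\<close> is the \<open>i\<close>-th digit of the entry of the image at \<open>\<beta> + c i\<close>\<close>
      have "Poly_Mapping.lookup (s i) \<beta> \<in> P_gt (truncation \<nu> Qn) \<beta>" for \<beta>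
      proof -
        let ?\<gamma> = "\<beta> + c i"
        let ?f = "\<lambda>j. Poly_Mapping.lookup (s j) (?\<gamma> - c j)"
        have "Poly_Mapping.lookup (\<Sum>j\<le>?d. s j * Y ^ j) ?\<gamma> = (\<Sum>j\<le>?d. ?f j * Qn ^ j)"
          by (simp add: lookup_sum Y_power lookup_mult_single)
        then have "Fin ?\<gamma> < truncation \<nu> Qn (\<Sum>j\<le>?d. ?f j * Qn ^ j)"
          using zero[of ?\<gamma>] by (simp add: P_gt_def)
        then have "Fin ?\<gamma> < \<nu> (Qn.digit (\<Sum>j\<le>?d. ?f j * Qn ^ j) i * Qn ^ i)"
          unfolding Qn.gt_tr_iff by blast
        then have "Fin (\<beta> + c i) < \<nu> (Poly_Mapping.lookup (s i) \<beta> * Qn ^ i)"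
          using low_degree_expansion[of Qn ?f ?d i, OF Qn.deg_pos s(3)] True by simp
        then have "Fin \<beta> < \<nu> (Poly_Mapping.lookup (s i) \<beta>)"
          by (cases "\<nu> (Poly_Mapping.lookup (s i) \<beta>)") (auto simp: valuation_mult[OF val] c)
        then show ?thesis by (simp add: P_gt_def Qn.tr_low[OF s(3)])
      qed
      then have "top.graded_class (r i) = \<zero>\<^bsub>G\<^esub>"
        using top.graded_class_zero_iff[OF s_top] s(2) by simp
      then show ?thesis using kernel[OF r(1)] r(2) by simp
    qed
    then show ?thesis using p(1) by (intro U.up_eqI) simp_all
  qed
  have inj: "inj_on ?E (carrier (UP L))"
  proof (rule inj_onI)
    fix p p' assume p: "p \<in> carrier (UP L)" "p' \<in> carrier (UP L)" "?E p = ?E p'"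
    have "?E (p \<ominus>\<^bsub>UP L\<^esub> p') = \<zero>\<^bsub>G\<^esub>"
      using p E.hom_closed by (simp add: a_minus_def G.r_neg)
    then have "p \<ominus>\<^bsub>UP L\<^esub> p' = \<zero>\<^bsub>UP L\<^esub>" using injective p U.minus_closed by blast
    then show "p = p'" using p U.r_right_minus_eq by blast
  qed
  have onto: "x \<in> ?E ` carrier (UP L)" if "x \<in> carrier G" for x
  proof -
    obtain r where r: "r \<in> top.rees" "x = top.graded_class r"
      using \<open>x \<in> carrier G\<close> unfolding pres.carrier_eq by blast
    let ?M = "{r \<in> top.rees. top.graded_class r \<in> ?E ` carrier (UP L)}"
    have M_sum: "(\<And>i. i \<in> A \<Longrightarrow> f i \<in> ?M) \<Longrightarrow> sum f A \<in> ?M" for f :: "'z \<Rightarrow> _" and A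
    proof (induct A rule: infinite_finite_induct)
      case (insert i A)
      then have "f i \<in> top.rees" "sum f A \<in> top.rees"
        "top.graded_class (f i) \<in> ?E ` carrier (UP L)" "top.graded_class (sum f A) \<in> ?E ` carrier (UP L)"
        by auto
      moreover then obtain p p' where "p \<in> carrier (UP L)" "p' \<in> carrier (UP L)"
        "top.graded_class (f i) = ?E p" "top.graded_class (sum f A) = ?E p'" by blast
      ultimately have "top.graded_class (f i + sum f A) = ?E (p \<oplus>\<^bsub>UP L\<^esub> p')"
        "p \<oplus>\<^bsub>UP L\<^esub> p' \<in> carrier (UP L)" "f i + sum f A \<in> top.rees"
        by (simp_all add: top.graded_class_add pres.add_in)
      then show ?case using insert.hyps by auto
    qed (use pres.zero_in pres.zero_eq E.hom_zero U.zero_closed in \<open>auto intro: image_eqI[of _ _ "\<zero>\<^bsub>UP L\<^esub>"]\<close>)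
    have "Poly_Mapping.single \<gamma> (Poly_Mapping.lookup r \<gamma>) \<in> ?M" for \<gamma>
    proof -
      let ?f = "Poly_Mapping.lookup r \<gamma>"
      have ge: "Fin \<gamma> \<le> truncation \<nu> Qn ?f" using top.lookup_in_ge[OF r(1)] by (simp add: P_ge_def)
      let ?s = "\<lambda>i. Poly_Mapping.single (\<gamma> - c i) (Qn.digit ?f i)"
      have "?s i * Y ^ i \<in> ?M" for i
      proof -
        have "Fin \<gamma> \<le> \<nu> (Qn.digit ?f i) + Fin (c i)"
          using order_trans[OF ge Qn.tr_le_digit[of ?f i]] by (simp add: valuation_mult[OF val] c)
        then have "Fin (\<gamma> - c i) \<le> \<nu> (Qn.digit ?f i)"
          by (cases "\<nu> (Qn.digit ?f i)") (auto simp: algebra_simps)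
        then have s: "?s i \<in> rees_limit"
          by (intro single_in_limit q_expansion_degree Qn.deg_pos)
        then have s_top: "?s i \<in> top.rees" using rees_limit_subset by blast
        have "?E (up_ring.monom (UP L) (system.limit_class (?s i)) i) = top.graded_class (?s i * Y ^ i)"
          using U.eval_monom[OF lim.closed[OF s] y, of i] h(2)[OF s]
            pres.mult_eq[OF s_top pres.power_in[OF Y]] by (simp add: y_power)
        moreover have "up_ring.monom (UP L) (system.limit_class (?s i)) i \<in> carrier (UP L)"
          by (rule U.monom_closed[OF lim.closed[OF s]])
        moreover have "?s i * Y ^ i \<in> top.rees" by (intro pres.mult_in pres.power_in s_top Y)
        ultimately show ?thesis by (metis (no_types, lifting) image_eqI mem_Collect_eq)
      qed
      then have "(\<Sum>i\<le>Polynomial.degree (q_expansion Qn ?f). ?s i * Y ^ i) \<in> ?M" by (rule M_sum)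
      also have "(\<Sum>i\<le>Polynomial.degree (q_expansion Qn ?f). ?s i * Y ^ i) =
          Poly_Mapping.single \<gamma> (\<Sum>i\<le>Polynomial.degree (q_expansion Qn ?f). Qn.digit ?f i * Qn ^ i)"
        by (rule poly_mapping_eqI)
          (simp add: lookup_sum lookup_single Y_power mult_single when_def)
      also have "\<dots> = Poly_Mapping.single \<gamma> ?f"
        using q_expansion_sum[OF Qn.deg_pos, of ?f] by simp
      finally show ?thesis .
    qed
    then have "(\<Sum>\<gamma>\<in>Poly_Mapping.keys r. Poly_Mapping.single \<gamma> (Poly_Mapping.lookup r \<gamma>)) \<in> ?M"
      by (rule M_sum)
    then show ?thesis using r(2) by (simp add: sum_singles)
  qed
  have "?E \<in> ring_iso (UP L) G"
    unfolding ring_iso_def bij_betw_def using E inj onto E.hom_closed by blast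
  then have "UP L \<simeq> G" unfolding is_ring_iso_def by blast
  then show ?thesis by (rule ring_iso_sym[OF U.ring_axioms])
qed

end

section \<open>The limit over the key polynomials of a fixed degree\<close>

theorem corollary5p6:
  fixes \<nu>0 :: "'k::field \<Rightarrow> 'g::linordered_ab_group_add extended"
    and \<nu> :: "'k poly \<Rightarrow> 'g extended"
    and \<nu>bar :: "'k alg_closure poly \<Rightarrow> 'g extended"
    and n :: nat
    and Qn :: "'k poly"
  assumes divisible: "\<And>(m::nat) (\<gamma>::'g). 0 < m \<Longrightarrow> \<exists>\<eta>. (\<Sum>i<m. \<eta>) = \<gamma>"
    and "valuation \<nu>0" and "supp \<nu>0 = {0}"
    and "valuation \<nu>" and extends: "\<And>c. \<nu> [:c:] = \<nu>0 c"
    and "valuation \<nu>bar" and extends_bar: "\<And>f. \<nu>bar (map_poly to_ac f) = \<nu> f"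
    and "\<Psi> \<nu>bar n \<noteq> {}"
    and no_max: "\<not> (\<exists>Q\<in>\<Psi> \<nu>bar n. \<forall>Q'\<in>\<Psi> \<nu>bar n. \<nu> Q' \<le> \<nu> Q)"
    and "limit_key_poly \<nu> (\<Psi> \<nu>bar n) Qn"
  shows "cring (truncation_limit \<nu> (\<Psi> \<nu>bar n))
       \<and> truncation_limit \<nu> (\<Psi> \<nu>bar n) \<simeq> low_degree_ring \<nu> Qn
       \<and> (Qn \<notin> supp \<nu> \<longrightarrow>
            graded_ring (truncation \<nu> Qn) \<simeq> UP (truncation_limit \<nu> (\<Psi> \<nu>bar n)))"
proof -
  have "0 < n"
  proof (rule ccontr)
    \<comment> \<open>the only key polynomial of degree zero is \<open>1\<close>\<close>
    assume "\<not> 0 < n"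
    then have "Q = 1" if "Q \<in> \<Psi> \<nu>bar n" for Q
      using that by (auto simp: key_polys_def key_poly_def one_pCons elim!: degree_eq_zeroE)
    then show False using no_max \<open>\<Psi> \<nu>bar n \<noteq> {}\<close> by (metis ex_in_conv order_refl)
  qed
  interpret limit_key \<nu> "\<Psi> \<nu>bar n" n Qn
  proof (rule limit_key.intro)
    show "abstract_key_poly \<nu> Q" if "Q \<in> \<Psi> \<nu>bar n" for Q
      using that \<open>0 < n\<close>
      by (intro key_poly_imp_abstract[OF \<open>valuation \<nu>\<close> \<open>valuation \<nu>bar\<close> extends_bar])
        (auto simp: key_polys_def)
    show "lead_coeff Q = 1" "Polynomial.degree Q = n" if "Q \<in> \<Psi> \<nu>bar n" for Q
      using that by (auto simp: key_polys_def key_poly_def)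
    show "\<exists>Q'\<in>\<Psi> \<nu>bar n. \<nu> Q < \<nu> Q'" if "Q \<in> \<Psi> \<nu>bar n" for Q
      using no_max that by (meson not_le)
  qed fact+
  show ?thesis
    using lim.is_cring limit_iso_low_degree_ring graded_ring_iso_polynomials
    by (auto simp: supp_def)
qed

end
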